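(* Let $H_1, \dots, H_m \in \mathcal{B}(\mathcal{H})$ be self-adjoint operators such that $W(H_1, \dots, H_m)$ is a simplex in $\mathbb{R}^m$. Then, for every Hilbert space $\mathcal{K}$, $(B_1, \dots, B_m) \in \mathcal{B}(\mathcal{K})^m$ has a joint dilation of the form $(I\otimes H_1, \dots, I\otimes H_m)$ whenever $W(B_1, \dots, B_m) \subseteq W(H_1, \dots, H_m)$. In other words, $\operatorname{span}\{I, H_1, \dots, H_m\}$ is a maximal operator system in $\mathcal{B}(\mathcal{H})$.
   Context: All Hilbert spaces are complex. $\mathcal{B}(\mathcal{H})$ is the algebra of bounded linear operators on a Hilbert space $\mathcal{H}$. The joint numerical range of $(T_1,\dots,T_m)\in\mathcal{B}(\mathcal{H})^m$ is $W(T_1,\dots,T_m)=\{(\langle T_1x,x\rangle,\dots,\langle T_mx,x\rangle): x\in\mathcal{H}, \langle x,x\rangle=1\}\subseteq\mathbb{C}^m$ (contained in $\mathbb{R}^m$ when the $T_j$ are self-adjoint). A simplex in $\mathbb{R}^m$ is the convex hull of $m+1$ affinely independent points (its $m+1$ vertices). A tuple $(B_1,\dots,B_m)\in\mathcal{B}(\mathcal{K})^m$ has a joint dilation of the form $(I\otimes H_1,\dots,I\otimes H_m)$ if there are a Hilbert space $\mathcal{L}$ and an operator $V:\mathcal{K}\to\mathcal{L}\otimes\mathcal{H}$ with $V^*V=I_{\mathcal{K}}$ such that $V^*(I_{\mathcal{L}}\otimes H_j)V=B_j$ for all $j=1,\dots,m$. An operator system in $\mathcal{B}(\mathcal{H})$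 is a self-adjoint linear subspace containing $I_{\mathcal{H}}$. A linear map $\Phi:\mathcal{S}\to\mathcal{B}(\mathcal{K})$ is unital if $\Phi(I_{\mathcal{H}})=I_{\mathcal{K}}$, positive if it maps positive semidefinite elements of $\mathcal{S}$ to positive semidefinite operators, and completely positive if for every $k\ge1$ the map $M_k(\mathcal{S})\to M_k(\mathcal{B}(\mathcal{K}))$, $(S_{ij})\mapsto(\Phi(S_{ij}))$, is positive. An operator system $\mathcal{S}$ is a maximal operator system (OMAX) if, for every Hilbert space $\mathcal{K}$, every unital positive map $\Phi:\mathcal{S}\to\mathcal{B}(\mathcal{K})$ is completely positive. *)

theory Defs
  imports "HOL-Analysis.Analysis"
begin

section \<open>Complex Hilbert spaces as types\<close>

text \<open>
  The complex inner product is linear in its first argument.  Norm, topology and completeness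
  are those of the underlying real Hilbert space with inner product \<open>Re \<langle>x, y\<rangle>\<close>.
\<close>

class chilbert_space = real_inner + complete_space +
  fixes scaleC :: "complex \<Rightarrow> 'a \<Rightarrow> 'a" (infixr "*\<^sub>C" 75)
    and cinner :: "'a \<Rightarrow> 'a \<Rightarrow> complex"
  assumes scaleC_add_right: "a *\<^sub>C (x + y) = a *\<^sub>C x + a *\<^sub>C y"
    and scaleC_add_left: "(a + b) *\<^sub>C x = a *\<^sub>C x + b *\<^sub>C x"
    and scaleC_scaleC: "a *\<^sub>C (b *\<^sub>C x) = (a * b) *\<^sub>C x"
    and scaleR_scaleC: "r *\<^sub>R x = complex_of_real r *\<^sub>C x"
    and cinner_commute: "cinner x y = cnj (cinner y x)"
    and cinner_add_left: "cinner (x + y) z = cinner x z + cinner y z"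
    and cinner_scaleC_left: "cinner (a *\<^sub>C x) y = a * cinner x y"
    and inner_eq_Re_cinner: "inner x y = Re (cinner x y)"

instantiation complex :: chilbert_space
begin

definition scaleC_complex :: "complex \<Rightarrow> complex \<Rightarrow> complex"
  where "scaleC_complex a x = a * x"

definition cinner_complex :: "complex \<Rightarrow> complex \<Rightarrow> complex"
  where "cinner_complex x y = x * cnj y"

instance
  by standard
    (auto simp: scaleC_complex_def cinner_complex_def inner_complex_def algebra_simps
       scaleR_conv_of_real)

end

text \<open>Elements of \<open>\<B>(\<H>, \<K>)\<close>.\<close>

definition bounded_clinear :: "('a::chilbert_space \<Rightarrow> 'b::chilbert_space) \<Rightarrow> bool"
  where "bounded_clinear f \<longleftrightarrow> bounded_linear f \<and> (\<forall>c x. f (c *\<^sub>C x) = c *\<^sub>C f x)"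

definition adjoint_of ::
    "('a::chilbert_space \<Rightarrow> 'b::chilbert_space) \<Rightarrow> ('b \<Rightarrow> 'a) \<Rightarrow> bool"
  where "adjoint_of f g \<longleftrightarrow> (\<forall>x y. cinner (f x) y = cinner x (g y))"

definition selfadjoint :: "('a::chilbert_space \<Rightarrow> 'a) \<Rightarrow> bool"
  where "selfadjoint f \<longleftrightarrow> adjoint_of f f"

definition joint_numerical_range ::
    "('m::finite \<Rightarrow> 'a::chilbert_space \<Rightarrow> 'a) \<Rightarrow> (complex ^ 'm) set"
  where "joint_numerical_range T = {(\<chi> j. cinner (T j x) x) | x. cinner x x = 1}"

text \<open>\<open>\<real>\<^sup>m\<close> as a subset of \<open>\<complex>\<^sup>m\<close>.\<close>

definition complex_vec :: "real ^ 'm \<Rightarrow> complex ^ 'm::finite"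
  where "complex_vec v = (\<chi> j. complex_of_real (v $ j))"


section \<open>Complex Hilbert spaces with a carrier set\<close>

text \<open>
  A joint dilation asserts the existence of a Hilbert space \<open>\<L>\<close>.  As one cannot quantify
  existentially over types, \<open>\<L>\<close> and \<open>\<L> \<otimes> \<H>\<close> are Hilbert spaces on carrier sets.
\<close>

record 'a hspace =
  carr :: "'a set"
  hzero :: 'a
  hadd :: "'a \<Rightarrow> 'a \<Rightarrow> 'a"
  hscale :: "complex \<Rightarrow> 'a \<Rightarrow> 'a"
  hip :: "'a \<Rightarrow> 'a \<Rightarrow> complex"

definition hnorm :: "'a hspace \<Rightarrow> 'a \<Rightarrow> real"
  where "hnorm X x = sqrt (Re (hip X x x))"

definition hdist :: "'a hspace \<Rightarrow> 'a \<Rightarrow> 'a \<Rightarrow> real"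
  where "hdist X x y = hnorm X (hadd X x (hscale X (-1) y))"

locale hilbert_space =
  fixes X :: "'a hspace"
  assumes zero_closed: "hzero X \<in> carr X"
    and add_closed: "\<lbrakk>x \<in> carr X; y \<in> carr X\<rbrakk> \<Longrightarrow> hadd X x y \<in> carr X"
    and scale_closed: "x \<in> carr X \<Longrightarrow> hscale X a x \<in> carr X"
    and add_assoc: "\<lbrakk>x \<in> carr X; y \<in> carr X; z \<in> carr X\<rbrakk> \<Longrightarrow>
          hadd X (hadd X x y) z = hadd X x (hadd X y z)"
    and add_commute: "\<lbrakk>x \<in> carr X; y \<in> carr X\<rbrakk> \<Longrightarrow> hadd X x y = hadd X y x"
    and add_zero: "x \<in> carr X \<Longrightarrow> hadd X (hzero X) x = x"
    and add_inverse: "x \<in> carr X \<Longrightarrow> \<exists>y\<in>carr X. hadd X x y = hzero X"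
    and scale_add_right: "\<lbrakk>x \<in> carr X; y \<in> carr X\<rbrakk> \<Longrightarrow>
          hscale X a (hadd X x y) = hadd X (hscale X a x) (hscale X a y)"
    and scale_add_left: "x \<in> carr X \<Longrightarrow>
          hscale X (a + b) x = hadd X (hscale X a x) (hscale X b x)"
    and scale_scale: "x \<in> carr X \<Longrightarrow> hscale X a (hscale X b x) = hscale X (a * b) x"
    and scale_one: "x \<in> carr X \<Longrightarrow> hscale X 1 x = x"
    and ip_commute: "\<lbrakk>x \<in> carr X; y \<in> carr X\<rbrakk> \<Longrightarrow> hip X x y = cnj (hip X y x)"
    and ip_add_left: "\<lbrakk>x \<in> carr X; y \<in> carr X; z \<in> carr X\<rbrakk> \<Longrightarrow>
          hip X (hadd X x y) z = hip X x z + hip X y z"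
    and ip_scale_left: "\<lbrakk>x \<in> carr X; y \<in> carr X\<rbrakk> \<Longrightarrow> hip X (hscale X a x) y = a * hip X x y"
    and ip_pos: "\<lbrakk>x \<in> carr X; x \<noteq> hzero X\<rbrakk> \<Longrightarrow> 0 < Re (hip X x x)"
    and complete:
      "\<lbrakk>\<And>n. s n \<in> carr X; \<forall>e>0. \<exists>N. \<forall>m\<ge>N. \<forall>n\<ge>N. hdist X (s m) (s n) < e\<rbrakk> \<Longrightarrow>
          \<exists>l\<in>carr X. (\<lambda>n::nat. hdist X (s n) l) \<longlonglongrightarrow> 0"

definition bounded_op :: "'a hspace \<Rightarrow> 'b hspace \<Rightarrow> ('a \<Rightarrow> 'b) \<Rightarrow> bool"
  where "bounded_op X Y f \<longleftrightarrow>
    (\<forall>x\<in>carr X. f x \<in> carr Y) \<and>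
    (\<forall>x\<in>carr X. \<forall>y\<in>carr X. f (hadd X x y) = hadd Y (f x) (f y)) \<and>
    (\<forall>a. \<forall>x\<in>carr X. f (hscale X a x) = hscale Y a (f x)) \<and>
    (\<exists>C. \<forall>x\<in>carr X. hnorm Y (f x) \<le> C * hnorm X x)"

definition adjoint_op :: "'a hspace \<Rightarrow> 'b hspace \<Rightarrow> ('a \<Rightarrow> 'b) \<Rightarrow> ('b \<Rightarrow> 'a) \<Rightarrow> bool"
  where "adjoint_op X Y f g \<longleftrightarrow>
    bounded_op Y X g \<and> (\<forall>x\<in>carr X. \<forall>y\<in>carr Y. hip Y (f x) y = hip X x (g y))"

text \<open>The Hilbert space whose carrier is a whole type; the two frameworks agree on it.\<close>

definition type_space :: "'a::chilbert_space hspace"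
  where "type_space = \<lparr>carr = UNIV, hzero = 0, hadd = (+), hscale = (*\<^sub>C), hip = cinner\<rparr>"

lemma type_space_simps [simp]:
  "carr type_space = UNIV" "hzero type_space = 0" "hadd type_space = (+)"
  "hscale type_space = (*\<^sub>C)" "hip type_space = cinner"
  by (simp_all add: type_space_def)

lemma scaleC_minus_one: "(-1) *\<^sub>C x = - (x :: 'a::chilbert_space)"
  using scaleR_scaleC[of "-1" x] by simp

lemma hnorm_type_space [simp]: "hnorm type_space x = norm x"
  by (simp add: hnorm_def norm_eq_sqrt_inner inner_eq_Re_cinner)

lemma hdist_type_space [simp]: "hdist type_space x y = dist x y"
  by (simp add: hdist_def scaleC_minus_one dist_norm)

lemma hilbert_space_type_space: "hilbert_space (type_space :: 'a::chilbert_space hspace)"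
proof
  show "hscale type_space 1 x = x" for x :: 'a
    using scaleR_scaleC[of 1 x] by simp
  show "\<exists>y\<in>carr type_space. hadd type_space x y = hzero type_space" for x :: 'a
    by (auto intro: exI[of _ "- x"])
  show "0 < Re (hip type_space x x)" if "x \<noteq> hzero type_space" for x :: 'a
    using that by (simp flip: inner_eq_Re_cinner)
  show "hip type_space x y = cnj (hip type_space y x)" for x y :: 'a
    using cinner_commute[of x y] by simp
  show "\<exists>l\<in>carr type_space. (\<lambda>n. hdist type_space (s n) l) \<longlonglongrightarrow> 0"
    if "\<forall>e>0. \<exists>N. \<forall>m\<ge>N. \<forall>n\<ge>N. hdist type_space (s m) (s n) < e" for s :: "nat \<Rightarrow> 'a"
  proof -
    have "Cauchy s" using that by (simp add: Cauchy_def)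
    then obtain l where "s \<longlonglongrightarrow> l" by (auto simp: Cauchy_convergent_iff convergent_def)
    then show ?thesis using tendsto_dist_iff[of s l sequentially] by auto
  qed
qed (auto simp: add_ac scaleC_add_right scaleC_add_left scaleC_scaleC
       cinner_add_left cinner_scaleC_left)

lemma bounded_op_type_space: "bounded_op type_space type_space f \<longleftrightarrow> bounded_clinear f"
proof
  assume "bounded_op type_space type_space f"
  then have add: "\<And>x y. f (x + y) = f x + f y" and scale: "\<And>a x. f (a *\<^sub>C x) = a *\<^sub>C f x"
    and "\<exists>C. \<forall>x. norm (f x) \<le> C * norm x"
    by (simp_all add: bounded_op_def)
  then obtain C where "\<And>x. norm (f x) \<le> norm x * C"
    by (metis mult.commute)
  with add scale have "bounded_linear f"
    by (intro bounded_linear_intro[where K = C]) (simp_all add: scaleR_scaleC)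
  with scale show "bounded_clinear f"
    by (simp add: bounded_clinear_def)
next
  assume "bounded_clinear f"
  then show "bounded_op type_space type_space f"
    using bounded_linear.bounded[of f]
    by (auto simp: bounded_op_def bounded_clinear_def linear_simps mult.commute)
qed


section \<open>Hilbert space tensor products and joint dilations\<close>

primrec hsum :: "'a hspace \<Rightarrow> (nat \<Rightarrow> 'a) \<Rightarrow> nat \<Rightarrow> 'a"
  where "hsum X f 0 = hzero X"
  | "hsum X f (Suc n) = hadd X (hsum X f n) (f n)"

text \<open>
  \<open>T\<close> with the bilinear map \<open>\<tau>\<close>, written \<open>(l, h) \<mapsto> l \<otimes> h\<close>, is the Hilbert space tensor product
  of \<open>L\<close> and \<open>M\<close>, i.e. the completion of the algebraic tensor product for the inner product
  \<open>\<langle>l \<otimes> h, l' \<otimes> h'\<rangle> = \<langle>l, l'\<rangle>\<langle>h, h'\<rangle>\<close>.  This determines \<open>(T, \<tau>)\<close> up to a unique unitary.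
\<close>

definition hilbert_tensor ::
    "'l hspace \<Rightarrow> 'h hspace \<Rightarrow> 't hspace \<Rightarrow> ('l \<Rightarrow> 'h \<Rightarrow> 't) \<Rightarrow> bool"
  where "hilbert_tensor L M T \<tau> \<longleftrightarrow>
    hilbert_space T \<and>
    (\<forall>l\<in>carr L. \<forall>h\<in>carr M. \<tau> l h \<in> carr T) \<and>
    (\<forall>l\<in>carr L. \<forall>l'\<in>carr L. \<forall>h\<in>carr M. \<tau> (hadd L l l') h = hadd T (\<tau> l h) (\<tau> l' h)) \<and>
    (\<forall>l\<in>carr L. \<forall>h\<in>carr M. \<forall>h'\<in>carr M. \<tau> l (hadd M h h') = hadd T (\<tau> l h) (\<tau> l h')) \<and>
    (\<forall>a. \<forall>l\<in>carr L. \<forall>h\<in>carr M. \<tau> (hscale L a l) h = hscale T a (\<tau> l h)) \<and>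
    (\<forall>a. \<forall>l\<in>carr L. \<forall>h\<in>carr M. \<tau> l (hscale M a h) = hscale T a (\<tau> l h)) \<and>
    (\<forall>l\<in>carr L. \<forall>l'\<in>carr L. \<forall>h\<in>carr M. \<forall>h'\<in>carr M.
       hip T (\<tau> l h) (\<tau> l' h') = hip L l l' * hip M h h') \<and>
    (\<forall>t\<in>carr T. \<forall>e>0. \<exists>n l h. (\<forall>i<n. l i \<in> carr L \<and> h i \<in> carr M) \<and>
       hdist T t (hsum T (\<lambda>i. \<tau> (l i) (h i)) n) < e)"

text \<open>\<open>A\<close> is the operator \<open>I \<otimes> S\<close> on \<open>T = L \<otimes> M\<close>; by density it is unique on the carrier.\<close>

definition ampliation ::
    "'l hspace \<Rightarrow> 'h hspace \<Rightarrow> 't hspace \<Rightarrow> ('l \<Rightarrow> 'h \<Rightarrow> 't) \<Rightarrow> ('h \<Rightarrow> 'h) \<Rightarrow> ('t \<Rightarrow> 't) \<Rightarrow> bool"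
  where "ampliation L M T \<tau> S A \<longleftrightarrow>
    bounded_op T T A \<and> (\<forall>l\<in>carr L. \<forall>h\<in>carr M. A (\<tau> l h) = \<tau> l (S h))"

text \<open>
  The types of \<open>L\<close> and \<open>T\<close> are large enough not to restrict the notion.  Given any dilation
  \<open>V\<close> into \<open>\<L> \<otimes> \<H>\<close>, one may replace \<open>\<L>\<close> by the closed span \<open>\<L>\<^sub>0\<close> of the vectors
  \<open>(id \<otimes> \<langle>-, h\<rangle>) (V k)\<close> with \<open>k \<in> \<K>\<close> and \<open>h \<in> \<H>\<close>, because \<open>V\<close> maps into \<open>\<L>\<^sub>0 \<otimes> \<H>\<close>.
  An orthonormal basis of \<open>\<L>\<^sub>0\<close> can be indexed by a set \<open>I \<subseteq> \<K> \<times> \<H>\<close>, so \<open>\<L>\<^sub>0\<close> and \<open>\<L>\<^sub>0 \<otimes> \<H>\<close>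
  are unitarily equivalent to \<open>\<ell>\<^sup>2(I)\<close> and \<open>\<ell>\<^sup>2(I; \<H>)\<close>, which live on the types below.
\<close>

definition has_joint_dilation ::
    "('m \<Rightarrow> 'h::chilbert_space \<Rightarrow> 'h) \<Rightarrow> ('m \<Rightarrow> 'k::chilbert_space \<Rightarrow> 'k) \<Rightarrow> bool"
  where "has_joint_dilation H B \<longleftrightarrow>
    (\<exists>(L :: ('k \<times> 'h \<Rightarrow> complex) hspace) (T :: ('k \<times> 'h \<Rightarrow> 'h) hspace) \<tau> V V' A.
       hilbert_space L \<and>
       hilbert_tensor L type_space T \<tau> \<and>
       bounded_op type_space T V \<and>
       adjoint_op type_space T V V' \<and>
       (\<forall>x. V' (V x) = x) \<and>
       (\<forall>j. ampliation L type_space T \<tau> (H j) (A j)) \<and>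
       (\<forall>j x. V' (A j (V x)) = B j x))"


section \<open>Operator systems\<close>

definition operator_system :: "('h::chilbert_space \<Rightarrow> 'h) set \<Rightarrow> bool"
  where "operator_system \<S> \<longleftrightarrow>
    (\<forall>S\<in>\<S>. bounded_clinear S) \<and>
    (\<lambda>x. x) \<in> \<S> \<and>
    (\<forall>S\<in>\<S>. \<forall>T\<in>\<S>. (\<lambda>x. S x + T x) \<in> \<S>) \<and>
    (\<forall>a. \<forall>S\<in>\<S>. (\<lambda>x. a *\<^sub>C S x) \<in> \<S>) \<and>
    (\<forall>S\<in>\<S>. \<exists>T\<in>\<S>. adjoint_of S T)"

text \<open>
  Positive semidefiniteness of \<open>(S\<^sub>i\<^sub>j) \<in> M\<^sub>k(\<B>(\<H>)) = \<B>(\<H>\<^sup>k)\<close>; matrix indices run over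
  \<open>{..<k}\<close>.
\<close>

definition psd_op :: "('h::chilbert_space \<Rightarrow> 'h) \<Rightarrow> bool"
  where "psd_op S \<longleftrightarrow> (\<forall>x. cinner (S x) x \<in> \<real>\<^sub>\<ge>\<^sub>0)"

definition psd_op_matrix :: "nat \<Rightarrow> (nat \<Rightarrow> nat \<Rightarrow> 'h::chilbert_space \<Rightarrow> 'h) \<Rightarrow> bool"
  where "psd_op_matrix k S \<longleftrightarrow>
    (\<forall>x :: nat \<Rightarrow> 'h. (\<Sum>i<k. cinner (\<Sum>j<k. S i j (x j)) (x i)) \<in> \<real>\<^sub>\<ge>\<^sub>0)"

definition linear_map_on ::
    "('h::chilbert_space \<Rightarrow> 'h) set \<Rightarrow> (('h \<Rightarrow> 'h) \<Rightarrow> ('k::chilbert_space \<Rightarrow> 'k)) \<Rightarrow> bool"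
  where "linear_map_on \<S> \<Phi> \<longleftrightarrow>
    (\<forall>S\<in>\<S>. bounded_clinear (\<Phi> S)) \<and>
    (\<forall>S\<in>\<S>. \<forall>T\<in>\<S>. \<Phi> (\<lambda>x. S x + T x) = (\<lambda>x. \<Phi> S x + \<Phi> T x)) \<and>
    (\<forall>a. \<forall>S\<in>\<S>. \<Phi> (\<lambda>x. a *\<^sub>C S x) = (\<lambda>x. a *\<^sub>C \<Phi> S x))"

definition unital_map :: "(('h::chilbert_space \<Rightarrow> 'h) \<Rightarrow> ('k::chilbert_space \<Rightarrow> 'k)) \<Rightarrow> bool"
  where "unital_map \<Phi> \<longleftrightarrow> \<Phi> (\<lambda>x. x) = (\<lambda>x. x)"

definition positive_map_on ::
    "('h::chilbert_space \<Rightarrow> 'h) set \<Rightarrow> (('h \<Rightarrow> 'h) \<Rightarrow> ('k::chilbert_space \<Rightarrow> 'k)) \<Rightarrow> bool"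
  where "positive_map_on \<S> \<Phi> \<longleftrightarrow> (\<forall>S\<in>\<S>. psd_op S \<longrightarrow> psd_op (\<Phi> S))"

definition completely_positive_on ::
    "('h::chilbert_space \<Rightarrow> 'h) set \<Rightarrow> (('h \<Rightarrow> 'h) \<Rightarrow> ('k::chilbert_space \<Rightarrow> 'k)) \<Rightarrow> bool"
  where "completely_positive_on \<S> \<Phi> \<longleftrightarrow>
    (\<forall>k\<ge>1. \<forall>S. (\<forall>i<k. \<forall>j<k. S i j \<in> \<S>) \<longrightarrow>
       psd_op_matrix k S \<longrightarrow> psd_op_matrix k (\<lambda>i j. \<Phi> (S i j)))"

text \<open>
  The target Hilbert space \<open>\<K>\<close> is the type argument; ``for every Hilbert space \<open>\<K>\<close>'' is
  expressed by stating the property for an arbitrary type \<open>'k\<close>.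
\<close>

definition maximal_operator_system ::
    "'k::chilbert_space itself \<Rightarrow> ('h::chilbert_space \<Rightarrow> 'h) set \<Rightarrow> bool"
  where "maximal_operator_system _ \<S> \<longleftrightarrow>
    operator_system \<S> \<and>
    (\<forall>\<Phi> :: ('h \<Rightarrow> 'h) \<Rightarrow> ('k \<Rightarrow> 'k).
       linear_map_on \<S> \<Phi> \<longrightarrow> unital_map \<Phi> \<longrightarrow> positive_map_on \<S> \<Phi> \<longrightarrow>
       completely_positive_on \<S> \<Phi>)"

definition span_with_identity ::
    "('m::finite \<Rightarrow> 'h::chilbert_space \<Rightarrow> 'h) \<Rightarrow> ('h \<Rightarrow> 'h) set"
  where "span_with_identity H = {(\<lambda>x. a *\<^sub>C x + (\<Sum>j\<in>UNIV. c j *\<^sub>C H j x)) | a c. True}"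

end

theory Submission
  imports Defs
begin

text \<open>
  Why the theorem holds.  Let \<open>C\<close> be the vertex set of the simplex.  The barycentric coordinates
  \<open>\<lambda>\<^sub>v\<close> (\<open>v \<in> C\<close>) are affine functions on \<open>\<real>\<^sup>m\<close> that are nonnegative on the simplex and satisfy
  \<open>\<Sum>\<^sub>v \<lambda>\<^sub>v = 1\<close> and \<open>\<Sum>\<^sub>v \<lambda>\<^sub>v(x) v = x\<close>.  An affine function can be evaluated at a tuple \<open>T\<close> of
  operators (\<open>coord_op T v\<close>).  If the joint numerical range of \<open>T\<close> lies in the simplex, the
  operators \<open>\<lambda>\<^sub>v(T)\<close> are positive, they sum to the identity, and \<open>T\<^sub>j = \<Sum>\<^sub>v v\<^sub>j \<lambda>\<^sub>v(T)\<close>.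

  For \<open>H\<close> the vertices themselves are attained: \<open>v = (\<langle>H\<^sub>j e\<^sub>v, e\<^sub>v\<rangle>)\<^sub>j\<close> for a unit vector \<open>e\<^sub>v\<close>.  Then
  \<open>\<langle>\<lambda>\<^sub>w(H) e\<^sub>v, e\<^sub>v\<rangle> = 0\<close> for \<open>w \<noteq> v\<close>, and by positivity even \<open>\<lambda>\<^sub>w(H) e\<^sub>v = 0\<close>.  So the \<open>e\<^sub>v\<close> are
  orthonormal joint eigenvectors, \<open>H\<^sub>j e\<^sub>v = v\<^sub>j e\<^sub>v\<close> (\<open>coord_op_vertex_vectors\<close>).

  Dilation.  With \<open>Q\<^sub>v = \<lambda>\<^sub>v(B) = R\<^sub>v\<^sup>* R\<^sub>v\<close> the map \<open>V x = \<Sum>\<^sub>v R\<^sub>v x \<otimes> e\<^sub>v\<close> is an isometry because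
  \<open>\<Sum>\<^sub>v Q\<^sub>v = I\<close>, and \<open>V\<^sup>* (I \<otimes> H\<^sub>j) V = \<Sum>\<^sub>v v\<^sub>j Q\<^sub>v = B\<^sub>j\<close>
  (\<open>has_joint_dilation_from_joint_eigenvectors\<close>).  Square roots would provide the factors \<open>R\<^sub>v\<close>,
  but any factorisation serves, and a more elementary one is a Cholesky decomposition carried out
  along a well-order of \<open>\<K>\<close> (\<open>transfinite_Cholesky\<close>).  It writes \<open>\<langle>Q y, z\<rangle>\<close> as a sum of terms
  \<open>f\<^sub>b(y) f\<^sub>b(z)\<^sup>*\<close> with linear functionals \<open>f\<^sub>b\<close>.  The numbers \<open>f\<^sub>b(x)\<close> are the coordinates of \<open>R x\<close> in
  an \<open>\<ell>\<^sup>2\<close> space, so that \<open>V\<close> maps into \<open>\<ell>\<^sup>2 \<otimes> \<H>\<close>, realised as the square-summable \<open>\<H>\<close>-valued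
  families.  The Riesz representation theorem provides \<open>V\<^sup>*\<close>.

  Maximality.  Every \<open>S\<close> in the span of \<open>I, H\<^sub>1, \<dots>, H\<^sub>m\<close> satisfies \<open>S e\<^sub>v = s\<^sub>v(S) e\<^sub>v\<close> and
  \<open>S = \<Sum>\<^sub>v s\<^sub>v(S) \<lambda>\<^sub>v(H)\<close>.  Compressing a positive matrix \<open>(S\<^sub>i\<^sub>j)\<close> to \<open>e\<^sub>v\<close> shows that the scalar
  matrices \<open>(s\<^sub>v(S\<^sub>i\<^sub>j))\<close> are positive.  A unital positive \<open>\<Phi>\<close> maps \<open>\<lambda>\<^sub>v(H)\<close> to a positive operator
  \<open>Q\<^sub>v\<close>, and \<open>(\<Phi>(S\<^sub>i\<^sub>j)) = \<Sum>\<^sub>v (s\<^sub>v(S\<^sub>i\<^sub>j)) \<otimes> Q\<^sub>v\<close> is positive as a sum of tensor products of positive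
  matrices with positive operators (\<open>psd_matrix_pairing_nonneg\<close>).
\<close>


section \<open>Complex inner products and bounded operators\<close>

lemma scaleC_zero_right [simp]: "a *\<^sub>C (0 :: 'a::chilbert_space) = 0"
  using scaleC_add_right[of a 0 "0 :: 'a"] by simp

lemma scaleC_zero_left [simp]: "0 *\<^sub>C (x :: 'a::chilbert_space) = 0"
  using scaleC_add_left[of 0 0 x] by simp

lemma scaleC_one [simp]: "1 *\<^sub>C (x :: 'a::chilbert_space) = x"
  using scaleR_scaleC[of 1 x] by simp

lemma scaleC_sum_right: "a *\<^sub>C (\<Sum>i\<in>F. f i :: 'a::chilbert_space) = (\<Sum>i\<in>F. a *\<^sub>C f i)"
  by (induction F rule: infinite_finite_induct) (simp_all add: scaleC_add_right)

lemma scaleC_sum_left: "(\<Sum>i\<in>F. f i) *\<^sub>C (x :: 'a::chilbert_space) = (\<Sum>i\<in>F. f i *\<^sub>C x)"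
  by (induction F rule: infinite_finite_induct) (simp_all add: scaleC_add_left)

lemma cinner_add_right: "cinner x (y + z) = cinner x y + cinner x z"
  by (metis cinner_add_left cinner_commute complex_cnj_add)

lemma cinner_scaleC_right: "cinner x (a *\<^sub>C y) = cnj a * cinner x y"
  by (metis cinner_scaleC_left cinner_commute complex_cnj_mult)

lemma cinner_zero_left [simp]: "cinner 0 x = 0"
  using cinner_scaleC_left[of 0 x x] by simp

lemma cinner_zero_right [simp]: "cinner x 0 = 0"
  using cinner_scaleC_right[of x 0 x] by simp

lemma cinner_minus_left [simp]: "cinner (- x) y = - cinner x y"
  using cinner_add_left[of x "- x" y] by (simp add: eq_neg_iff_add_eq_0 add.commute)

lemma cinner_minus_right [simp]: "cinner x (- y) = - cinner x y"
  by (metis cinner_commute cinner_minus_left complex_cnj_minus)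

lemma cinner_diff_right: "cinner x (y - z) = cinner x y - cinner x z"
  using cinner_add_right[of x y "- z"] by simp

lemma cinner_sum_left: "cinner (\<Sum>i\<in>F. f i) x = (\<Sum>i\<in>F. cinner (f i) x)"
  by (induction F rule: infinite_finite_induct) (simp_all add: cinner_add_left)

lemma cinner_sum_right: "cinner x (\<Sum>i\<in>F. f i) = (\<Sum>i\<in>F. cinner x (f i))"
  by (induction F rule: infinite_finite_induct) (simp_all add: cinner_add_right)

lemma cinner_self: "cinner x x = complex_of_real ((norm x)\<^sup>2)"
proof (rule complex_eqI)
  show "Re (cinner x x) = Re (complex_of_real ((norm x)\<^sup>2))"
    by (simp add: power2_norm_eq_inner flip: inner_eq_Re_cinner)
  have "Im (cinner x x) = - Im (cinner x x)"
    using arg_cong[OF cinner_commute[of x x], of Im] by simp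
  then show "Im (cinner x x) = Im (complex_of_real ((norm x)\<^sup>2))"
    by simp
qed

lemma cinner_self_eq_zero [simp]: "cinner x x = 0 \<longleftrightarrow> x = 0"
  by (simp add: cinner_self)

lemma norm_scaleC: "norm (a *\<^sub>C x) = cmod a * norm x"
proof -
  have "cinner (a *\<^sub>C x) (a *\<^sub>C x) = (a * cnj a) * cinner x x"
    by (simp add: cinner_scaleC_left cinner_scaleC_right)
  then have "complex_of_real ((norm (a *\<^sub>C x))\<^sup>2) = complex_of_real ((cmod a * norm x)\<^sup>2)"
    by (simp only: cinner_self complex_norm_square[symmetric] of_real_mult[symmetric]
        power_mult_distrib)
  then show ?thesis
    by (metis of_real_eq_iff norm_ge_zero mult_nonneg_nonneg power2_eq_iff_nonneg)
qed

lemma cinner_extensionality: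
  assumes "\<And>z. cinner z x = cinner z y"
  shows "x = y"
  using assms[of "x - y"] by (metis cinner_diff_right cinner_self_eq_zero eq_iff_diff_eq_0)

lemma bounded_clinear_add: "bounded_clinear S \<Longrightarrow> S (x + y) = S x + S y"
  by (auto simp: bounded_clinear_def linear_simps)

lemma bounded_clinear_scaleC: "bounded_clinear S \<Longrightarrow> S (a *\<^sub>C x) = a *\<^sub>C S x"
  by (simp add: bounded_clinear_def)

lemma bounded_clinear_sum: "bounded_clinear S \<Longrightarrow> S (\<Sum>i\<in>F. g i) = (\<Sum>i\<in>F. S (g i))"
  unfolding bounded_clinear_def by (blast intro: linear_sum bounded_linear.linear)

lemma bounded_clinear_id: "bounded_clinear (\<lambda>x. x)"
  by (simp add: bounded_clinear_def bounded_linear_ident)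

lemma bounded_clinear_zero: "bounded_clinear (\<lambda>x. 0)"
  by (simp add: bounded_clinear_def)

lemma bounded_clinear_plus:
  "bounded_clinear S \<Longrightarrow> bounded_clinear T \<Longrightarrow> bounded_clinear (\<lambda>x. S x + T x)"
  by (simp add: bounded_clinear_def bounded_linear_add scaleC_add_right)

lemma bounded_linear_scaleC: "bounded_linear ((*\<^sub>C) a)"
  by (rule bounded_linear_intro[where K = "cmod a"])
    (simp_all add: scaleC_add_right scaleR_scaleC scaleC_scaleC norm_scaleC mult.commute)

lemma bounded_clinear_scale: "bounded_clinear S \<Longrightarrow> bounded_clinear (\<lambda>x. a *\<^sub>C S x)"
  using bounded_linear_compose[OF bounded_linear_scaleC[of a], of S]
  by (simp add: bounded_clinear_def scaleC_scaleC mult.commute)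

lemma bounded_clinear_linear_combination:
  assumes "\<And>i. i \<in> F \<Longrightarrow> bounded_clinear (S i)"
  shows "bounded_clinear (\<lambda>x. \<Sum>i\<in>F. a i *\<^sub>C S i x)"
  using assms
  by (induction F rule: infinite_finite_induct)
    (simp_all add: bounded_clinear_zero bounded_clinear_plus bounded_clinear_scale)


section \<open>Positive semidefinite sesquilinear forms\<close>

definition clinear_functional :: "('k::chilbert_space \<Rightarrow> complex) \<Rightarrow> bool"
  where "clinear_functional f \<longleftrightarrow>
    (\<forall>x y. f (x + y) = f x + f y) \<and> (\<forall>a x. f (a *\<^sub>C x) = a * f x)"

locale psd_form =
  fixes q :: "'k::chilbert_space \<Rightarrow> 'k \<Rightarrow> complex"
  assumes add_left: "q (x + y) z = q x z + q y z"
    and scale_left: "q (a *\<^sub>C x) z = a * q x z"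
    and hermitian: "q x y = cnj (q y x)"
    and nonneg: "0 \<le> Re (q x x)"
begin

lemma add_right: "q z (x + y) = q z x + q z y"
  by (metis add_left hermitian complex_cnj_add)

lemma scale_right: "q z (a *\<^sub>C x) = cnj a * q z x"
  by (metis scale_left hermitian complex_cnj_mult)

lemma diagonal_real: "q x x = complex_of_real (Re (q x x))"
proof -
  have "Im (q x x) = - Im (q x x)"
    using arg_cong[OF hermitian[of x x], of Im] by simp
  then show ?thesis
    by (simp add: complex_eq_iff)
qed

lemma clinear_left: "clinear_functional (\<lambda>x. q x y)"
  by (simp add: clinear_functional_def add_left scale_left)

text \<open>
  The Cauchy--Schwarz inequality is divided by \<open>q y y\<close> because the left-hand side is then the
  squared modulus of a normalised column of \<open>q\<close>, the quantity that occurs in the elimination below.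
  Its value for isotropic \<open>y\<close> is zero by the convention on division.
\<close>

lemma Cauchy_Schwarz: "(cmod (q x y))\<^sup>2 / Re (q y y) \<le> Re (q x x)"
proof (cases "Re (q y y) = 0")
  case True
  then show ?thesis
    using nonneg[of x] by simp
next
  case False
  define c where "c = Re (q y y)"
  \<comment> \<open>\<open>x - t y\<close> is the component of \<open>x\<close> that is \<open>q\<close>-orthogonal to \<open>y\<close>.\<close>
  define t where "t = q x y / c"
  have c: "c > 0" and qyy: "q y y = c"
    using False nonneg[of y] diagonal_real[of y] by (auto simp: c_def)
  have "q (x + (- t) *\<^sub>C y) (x + (- t) *\<^sub>C y)
      = q x x - cnj t * q x y - t * cnj (q x y) + t * cnj t * c"
    using hermitian[of y x]
    by (simp add: add_left add_right scale_left scale_right qyy algebra_simps)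
  also have "\<dots> = q x x - complex_of_real ((cmod (q x y))\<^sup>2 / c)"
    using c by (simp add: t_def complex_norm_square field_simps del: of_real_power)
  finally have "Re (q x x) - (cmod (q x y))\<^sup>2 / c = Re (q (x + (- t) *\<^sub>C y) (x + (- t) *\<^sub>C y))"
    by simp
  then show ?thesis
    using nonneg[of "x + (- t) *\<^sub>C y"] by (simp add: c_def)
qed

text \<open>
  If \<open>q x y\<close> were nonzero, then adding suitable multiples of the isotropic vector \<open>x\<close> to \<open>y\<close> would
  lower the diagonal value \<open>q y y\<close> linearly, hence below zero.
\<close>

lemma isotropic_orthogonal:
  assumes "Re (q x x) = 0"
  shows "q x y = 0"
proof (rule ccontr)
  assume "q x y \<noteq> 0"
  define c where "c = (cmod (q x y))\<^sup>2"
  \<comment> \<open>With this step length the diagonal value becomes exactly \<open>-1\<close>.\<close>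
  define s where "s = (Re (q y y) + 1) / (2 * c)"
  have c: "c > 0" and cc: "cnj (q x y) * q x y = complex_of_real c"
    using \<open>q x y \<noteq> 0\<close> by (simp_all add: c_def complex_norm_square mult.commute del: of_real_power)
  have "q x x = 0"
    using assms diagonal_real[of x] by simp
  then have "q ((- s * cnj (q x y)) *\<^sub>C x + y) ((- s * cnj (q x y)) *\<^sub>C x + y)
      = q y y - s * (cnj (q x y) * q x y) - s * (cnj (q x y) * q x y)"
    unfolding add_left add_right scale_left scale_right hermitian[of y x] by simp
  also have "\<dots> = q y y - complex_of_real (2 * s * c)"
    by (simp only: cc) simp
  also have "2 * s * c = Re (q y y) + 1"
    using c by (simp add: s_def)
  finally show False
    using nonneg[of "(- s * cnj (q x y)) *\<^sub>C x + y"] by simp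
qed

end

lemma cmod_cinner_le: "cmod (cinner x y) \<le> norm x * norm y"
proof -
  interpret psd_form "cinner :: 'a \<Rightarrow> 'a \<Rightarrow> complex"
    by standard (rule cinner_add_left cinner_scaleC_left cinner_commute |
        simp flip: inner_eq_Re_cinner)+
  show ?thesis
  proof (cases "y = 0")
    case False
    then have "(cmod (cinner x y))\<^sup>2 \<le> (norm x * norm y)\<^sup>2"
      using Cauchy_Schwarz[of x y] by (simp add: cinner_self field_simps)
    then show ?thesis
      by (rule power2_le_imp_le) simp
  qed simp
qed

lemma summable_on_if_finite_sums_bounded:
  fixes f :: "'i \<Rightarrow> real"
  assumes "\<And>i. i \<in> A \<Longrightarrow> 0 \<le> f i"
    and "\<And>F. finite F \<Longrightarrow> F \<subseteq> A \<Longrightarrow> sum f F \<le> c"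
  shows "f summable_on A" "infsum f A \<le> c"
proof -
  show "f summable_on A"
    using assms by (intro nonneg_bdd_above_summable_on bdd_aboveI[of _ c]) auto
  then show "infsum f A \<le> c"
    using assms(2) by (rule infsum_le_finite_sums)
qed

lemma summable_on_mult_cnj:
  fixes f g :: "'i \<Rightarrow> complex"
  assumes "(\<lambda>i. (cmod (f i))\<^sup>2) summable_on A" "(\<lambda>i. (cmod (g i))\<^sup>2) summable_on A"
  shows "(\<lambda>i. f i * cnj (g i)) summable_on A"
proof (rule abs_summable_summable)
  have 1: "(\<lambda>i. (cmod (f i))\<^sup>2 + (cmod (g i))\<^sup>2) summable_on A"
    using assms by (rule summable_on_add)
  have 2: "norm (f i * cnj (g i)) \<le> (cmod (f i))\<^sup>2 + (cmod (g i))\<^sup>2" for i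
    using sum_squares_bound[of "cmod (f i)" "cmod (g i)"]
      mult_nonneg_nonneg[OF norm_ge_zero norm_ge_zero, of "f i" "g i"]
    unfolding norm_mult complex_mod_cnj by linarith
  show "(\<lambda>i. norm (f i * cnj (g i))) summable_on A"
    by (rule Infinite_Sum.abs_summable_on_comparison_test'[OF 1 2])
qed

text \<open>
  The state of the elimination after the pivots in \<open>A\<close>.  Only the diagonal values of finitely many
  rank one forms are assumed to be dominated; square-summability of \<open>f b y\<close> in \<open>b\<close> follows, and with
  it the convergence of the off-diagonal sums.
\<close>

lemma (in psd_form) residual_psd_form:
  assumes lin: "\<And>b. b \<in> A \<Longrightarrow> clinear_functional (f b)"
    and bound: "\<And>F y. finite F \<Longrightarrow> F \<subseteq> A \<Longrightarrow> (\<Sum>b\<in>F. (cmod (f b y))\<^sup>2) \<le> Re (q y y)"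
  shows "(\<lambda>b. f b y * cnj (f b z)) summable_on A" (is ?summable)
    and "(\<lambda>b. (cmod (f b y))\<^sup>2) summable_on A"
    and "Re (\<Sum>\<^sub>\<infinity>b\<in>A. f b y * cnj (f b y)) = (\<Sum>\<^sub>\<infinity>b\<in>A. (cmod (f b y))\<^sup>2)"
    and "psd_form (\<lambda>y z. q y z - (\<Sum>\<^sub>\<infinity>b\<in>A. f b y * cnj (f b z)))"
proof -
  have sq: "(\<lambda>b. (cmod (f b y))\<^sup>2) summable_on A"
    and le: "(\<Sum>\<^sub>\<infinity>b\<in>A. (cmod (f b y))\<^sup>2) \<le> Re (q y y)" for y
    using summable_on_if_finite_sums_bounded[of A "\<lambda>b. (cmod (f b y))\<^sup>2", OF _ bound] by simp_all
  have sm: "(\<lambda>b. f b y * cnj (f b z)) summable_on A" for y z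
    by (intro summable_on_mult_cnj sq)
  have diag: "Re (\<Sum>\<^sub>\<infinity>b\<in>A. f b y * cnj (f b y)) = (\<Sum>\<^sub>\<infinity>b\<in>A. (cmod (f b y))\<^sup>2)" for y
    by (subst infsum_Re[OF sm, symmetric]) (simp flip: complex_norm_square)
  show ?summable "(\<lambda>b. (cmod (f b y))\<^sup>2) summable_on A"
    "Re (\<Sum>\<^sub>\<infinity>b\<in>A. f b y * cnj (f b y)) = (\<Sum>\<^sub>\<infinity>b\<in>A. (cmod (f b y))\<^sup>2)"
    by (fact sm sq diag)+
  show "psd_form (\<lambda>y z. q y z - (\<Sum>\<^sub>\<infinity>b\<in>A. f b y * cnj (f b z)))"
  proof
    fix x y z :: 'k and a :: complex
    have "(\<Sum>\<^sub>\<infinity>b\<in>A. f b (x + y) * cnj (f b z))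
        = (\<Sum>\<^sub>\<infinity>b\<in>A. f b x * cnj (f b z) + f b y * cnj (f b z))"
      using lin by (intro infsum_cong) (simp add: clinear_functional_def algebra_simps)
    also have "\<dots> = (\<Sum>\<^sub>\<infinity>b\<in>A. f b x * cnj (f b z)) + (\<Sum>\<^sub>\<infinity>b\<in>A. f b y * cnj (f b z))"
      by (intro infsum_add sm)
    finally show "q (x + y) z - (\<Sum>\<^sub>\<infinity>b\<in>A. f b (x + y) * cnj (f b z))
        = q x z - (\<Sum>\<^sub>\<infinity>b\<in>A. f b x * cnj (f b z)) + (q y z - (\<Sum>\<^sub>\<infinity>b\<in>A. f b y * cnj (f b z)))"
      by (simp add: add_left)
    have "(\<Sum>\<^sub>\<infinity>b\<in>A. f b (a *\<^sub>C x) * cnj (f b z)) = (\<Sum>\<^sub>\<infinity>b\<in>A. a * (f b x * cnj (f b z)))"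
      using lin by (intro infsum_cong) (simp add: clinear_functional_def)
    also have "\<dots> = a * (\<Sum>\<^sub>\<infinity>b\<in>A. f b x * cnj (f b z))"
      by (intro infsum_cmult_right sm)
    finally show "q (a *\<^sub>C x) z - (\<Sum>\<^sub>\<infinity>b\<in>A. f b (a *\<^sub>C x) * cnj (f b z))
        = a * (q x z - (\<Sum>\<^sub>\<infinity>b\<in>A. f b x * cnj (f b z)))"
      by (simp add: scale_left algebra_simps)
    have "cnj (\<Sum>\<^sub>\<infinity>b\<in>A. f b y * cnj (f b x)) = (\<Sum>\<^sub>\<infinity>b\<in>A. f b x * cnj (f b y))"
      by (subst infsum_cnj[symmetric]) (simp add: mult.commute)
    then show "q x y - (\<Sum>\<^sub>\<infinity>b\<in>A. f b x * cnj (f b y))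
        = cnj (q y x - (\<Sum>\<^sub>\<infinity>b\<in>A. f b y * cnj (f b x)))"
      by (simp add: hermitian[of x y])
    show "0 \<le> Re (q x x - (\<Sum>\<^sub>\<infinity>b\<in>A. f b x * cnj (f b x)))"
      using le[of x] by (simp add: diag)
  qed
qed

lemma finite_has_greatest_wrt_Well_order:
  assumes "Well_order r" "finite F" "F \<noteq> {}" "F \<subseteq> Field r"
  shows "\<exists>m\<in>F. \<forall>b\<in>F. (b, m) \<in> r"
  using assms(2-)
proof (induction rule: finite_ne_induct)
  case (singleton x)
  then show ?case
    using assms(1) by (auto simp: order_on_defs refl_on_def)
next
  case (insert x F)
  then obtain m where m: "m \<in> F" "\<forall>b\<in>F. (b, m) \<in> r"
    by auto
  have "x \<in> Field r" "m \<in> Field r" "refl_on (Field r) r" "total_on (Field r) r"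
    using assms(1) insert.prems m(1) by (auto simp: order_on_defs)
  then have x: "(x, x) \<in> r" and tot: "(x, m) \<in> r \<or> (m, x) \<in> r"
    unfolding refl_on_def total_on_def by (simp, metis)
  have trans: "trans r"
    using assms(1) by (simp add: order_on_defs)
  show ?case
    using tot
  proof
    assume "(x, m) \<in> r"
    then show ?thesis
      using m by blast
  next
    assume "(m, x) \<in> r"
    then have "\<forall>b\<in>F. (b, x) \<in> r"
      using m(2) trans by (meson transD)
    then show ?thesis
      using x by blast
  qed
qed

text \<open>
  Cholesky elimination in which every vector of the space is a pivot, in the order of a well-order.
  At stage \<open>x\<close> the functional \<open>f x\<close> is the column at \<open>x\<close> of the current residual form, normalised
  so that subtracting the rank one form of \<open>f x\<close> makes the diagonal value at \<open>x\<close> vanish.  By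
  Cauchy--Schwarz the residual stays positive, so later stages cannot disturb this zero.  After all
  stages the residual is a positive form with zero diagonal, hence zero.
\<close>

theorem (in psd_form) transfinite_Cholesky:
  obtains f :: "'k \<Rightarrow> 'k \<Rightarrow> complex"
  where "\<And>b. clinear_functional (f b)"
    and "\<And>y z. ((\<lambda>b. f b y * cnj (f b z)) has_sum q y z) UNIV"
proof -
  obtain r :: "'k rel" where r: "Well_order r" "Field r = UNIV"
    using well_ordering[where 'a = 'k] by (elim exE conjE)
  define R where "R = r - Id"
  define below where "below x = {b. (b, x) \<in> R}" for x
  have wf: "wf R"
    using r(1) unfolding R_def well_order_on_def by (rule conjunct2)
  \<comment> \<open>\<open>P f x g\<close>: given the earlier functionals \<open>f\<close>, the functional \<open>g\<close> may be chosen at stage \<open>x\<close>.\<close>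
  define P where "P f x g \<longleftrightarrow> clinear_functional g
      \<and> (\<forall>F y. finite F \<longrightarrow> F \<subseteq> below x \<longrightarrow>
           (\<Sum>b\<in>F. (cmod (f b y))\<^sup>2) + (cmod (g y))\<^sup>2 \<le> Re (q y y))
      \<and> (\<Sum>\<^sub>\<infinity>b\<in>below x. (cmod (f b x))\<^sup>2) + (cmod (g x))\<^sup>2 = Re (q x x)"
    for f :: "'k \<Rightarrow> 'k \<Rightarrow> complex" and x g
  have bound: "(\<Sum>b\<in>F. (cmod (f b y))\<^sup>2) \<le> Re (q y y)"
    if F: "finite F" "\<And>b. b \<in> F \<Longrightarrow> P f b (f b)" for f F y
  proof (cases "F = {}")
    case True
    then show ?thesis
      using nonneg[of y] by simp
  next
    case False
    then obtain m where m: "m \<in> F" "\<forall>b\<in>F. (b, m) \<in> r"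
      using finite_has_greatest_wrt_Well_order[of r F] r F by auto
    then have "F - {m} \<subseteq> below m"
      by (auto simp: below_def R_def)
    then have "(\<Sum>b\<in>F - {m}. (cmod (f b y))\<^sup>2) + (cmod (f m y))\<^sup>2 \<le> Re (q y y)"
      using F m(1) by (auto simp: P_def)
    then show ?thesis
      using F(1) m(1) by (simp add: sum.remove[OF F(1) m(1)] add.commute)
  qed
  have "\<exists>f. \<forall>x. P f x (f x)"
  proof (rule dependent_wf_choice[OF wf])
    fix f g :: "'k \<Rightarrow> 'k \<Rightarrow> complex" and x h
    assume eq: "\<And>z. (z, x) \<in> R \<Longrightarrow> f z = g z"
    have "(\<Sum>b\<in>F. (cmod (f b y))\<^sup>2) = (\<Sum>b\<in>F. (cmod (g b y))\<^sup>2)" if "F \<subseteq> below x" for F y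
      using that eq by (intro sum.cong) (auto simp: below_def)
    moreover have "(\<Sum>\<^sub>\<infinity>b\<in>below x. (cmod (f b x))\<^sup>2) = (\<Sum>\<^sub>\<infinity>b\<in>below x. (cmod (g b x))\<^sup>2)"
      using eq by (intro infsum_cong) (auto simp: below_def)
    ultimately show "P f x h = P g x h"
      by (auto simp: P_def)
  next
    fix x and f :: "'k \<Rightarrow> 'k \<Rightarrow> complex"
    assume IH: "\<And>y. (y, x) \<in> R \<Longrightarrow> P f y (f y)"
    have lin: "clinear_functional (f b)" if "b \<in> below x" for b
      using IH[of b] that by (simp add: below_def P_def)
    have bd: "(\<Sum>b\<in>F. (cmod (f b y))\<^sup>2) \<le> Re (q y y)" if "finite F" "F \<subseteq> below x" for F y
      using that IH by (intro bound) (auto simp: below_def)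
    note res = residual_psd_form[OF lin bd]
    define p where "p y z = q y z - (\<Sum>\<^sub>\<infinity>b\<in>below x. f b y * cnj (f b z))" for y z
    interpret p: psd_form p
      unfolding p_def by (rule res)
    have p_diag: "Re (p y y) = Re (q y y) - (\<Sum>\<^sub>\<infinity>b\<in>below x. (cmod (f b y))\<^sup>2)" for y
      by (simp add: p_def res(3))
    \<comment> \<open>If \<open>x\<close> is isotropic for the residual form, the denominator is zero and so is \<open>g\<close>.\<close>
    define g where "g y = p y x / complex_of_real (sqrt (Re (p x x)))" for y
    have g_sq: "(cmod (g y))\<^sup>2 = (cmod (p y x))\<^sup>2 / Re (p x x)" for y
      using p.nonneg[of x] by (simp add: g_def norm_divide power_divide)
    have "P f x g"
      unfolding P_def
    proof (intro conjI allI impI)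
      show "clinear_functional g"
        using p.clinear_left[of x]
        by (simp add: clinear_functional_def g_def add_divide_distrib)
      fix F y
      assume F: "finite F" "F \<subseteq> below x"
      have "(\<Sum>b\<in>F. (cmod (f b y))\<^sup>2) \<le> (\<Sum>\<^sub>\<infinity>b\<in>below x. (cmod (f b y))\<^sup>2)"
        using F by (intro finite_sum_le_infsum res(2)) auto
      moreover have "(cmod (g y))\<^sup>2 \<le> Re (p y y)"
        unfolding g_sq by (rule p.Cauchy_Schwarz)
      ultimately show "(\<Sum>b\<in>F. (cmod (f b y))\<^sup>2) + (cmod (g y))\<^sup>2 \<le> Re (q y y)"
        by (simp add: p_diag)
    next
      have "cmod (p x x) = \<bar>Re (p x x)\<bar>"
        by (metis p.diagonal_real norm_of_real)
      then have "(cmod (g x))\<^sup>2 = Re (p x x)"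
        unfolding g_sq by (simp add: power2_eq_square)
      then show "(\<Sum>\<^sub>\<infinity>b\<in>below x. (cmod (f b x))\<^sup>2) + (cmod (g x))\<^sup>2 = Re (q x x)"
        by (simp add: p_diag)
    qed
    then show "\<exists>g. P f x g"
      by (rule exI[where x = g])
  qed
  then obtain f where f: "\<And>x. P f x (f x)"
    by blast
  have lin: "clinear_functional (f b)" for b
    using f by (simp add: P_def)
  have bd: "(\<Sum>b\<in>F. (cmod (f b y))\<^sup>2) \<le> Re (q y y)" if "finite F" for F y
    using that f by (intro bound) auto
  note res = residual_psd_form[of UNIV f, OF lin bd]
  define p where "p y z = q y z - (\<Sum>\<^sub>\<infinity>b\<in>UNIV. f b y * cnj (f b z))" for y z
  interpret p: psd_form p
    unfolding p_def by (rule res)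
  have "Re (p x x) = 0" for x
  proof -
    have "Re (q x x) = (\<Sum>\<^sub>\<infinity>b\<in>insert x (below x). (cmod (f b x))\<^sup>2)"
      \<comment> \<open>Stage \<open>x\<close> has exhausted the diagonal value at \<open>x\<close>.\<close>
      using f[of x] residual_psd_form(2)[of "below x" f, OF lin bd]
      by (subst infsum_insert) (auto simp: P_def below_def R_def)
    also have "\<dots> \<le> (\<Sum>\<^sub>\<infinity>b\<in>UNIV. (cmod (f b x))\<^sup>2)"
      by (intro infsum_mono2 residual_psd_form(2) lin bd) auto
    finally show ?thesis
      using p.nonneg[of x] by (simp add: p_def res(3))
  qed
  then have "p y z = 0" for y z
    by (rule p.isotropic_orthogonal)
  then have "((\<lambda>b. f b y * cnj (f b z)) has_sum q y z) UNIV" for y z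
    using res(1)[of y z] by (simp add: p_def has_sum_infsum)
  then show ?thesis
    using that lin by blast
qed


section \<open>Positive semidefinite operators as sums of rank one operators\<close>

text \<open>A positive operator on a complex space is automatically symmetric, by polarisation.\<close>

lemma psd_op_psd_form:
  assumes S: "bounded_clinear S" and psd: "psd_op S"
  shows "psd_form (\<lambda>x y. cinner (S x) y)"
proof
  fix x y z :: 'a and a :: complex
  note linear = bounded_clinear_add[OF S] bounded_clinear_scaleC[OF S]
    cinner_add_left cinner_add_right cinner_scaleC_left cinner_scaleC_right
  show "cinner (S (x + y)) z = cinner (S x) z + cinner (S y) z"
    "cinner (S (a *\<^sub>C x)) z = a * cinner (S x) z"
    by (simp_all add: linear)
  have real: "Im (cinner (S x) x) = 0" for x
    using psd by (simp add: psd_op_def complex_nonneg_Reals_iff)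
  show "0 \<le> Re (cinner (S x) x)"
    using psd by (simp add: psd_op_def complex_nonneg_Reals_iff)
  show "cinner (S x) y = cnj (cinner (S y) x)"
  proof (rule complex_eqI)
    show "Im (cinner (S x) y) = Im (cnj (cinner (S y) x))"
      using real[of "x + y"] by (simp add: linear real)
    show "Re (cinner (S x) y) = Re (cnj (cinner (S y) x))"
      using real[of "x + \<i> *\<^sub>C y"] by (simp add: linear real)
  qed
qed

lemma psd_op_symmetric:
  assumes "bounded_clinear S" "psd_op S"
  shows "cinner (S x) y = cinner x (S y)"
  using psd_form.hermitian[OF psd_op_psd_form[OF assms], of x y] cinner_commute[of x "S y"]
  by simp

text \<open>
  The Cholesky functionals are indexed by the space itself.  They are padded with zero functionals to
  the index type \<open>'k \<times> 'h\<close>, over which the spaces in \<open>has_joint_dilation\<close> consist of functions.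
\<close>

lemma psd_op_sum_of_rank_one:
  fixes S :: "'k::chilbert_space \<Rightarrow> 'k"
  assumes "bounded_clinear S" "psd_op S"
  shows "\<exists>f :: 'k \<times> 'h::zero \<Rightarrow> 'k \<Rightarrow> complex. (\<forall>i. clinear_functional (f i)) \<and>
    (\<forall>y z. ((\<lambda>i. f i y * cnj (f i z)) has_sum cinner (S y) z) UNIV)"
proof -
  interpret psd_form "\<lambda>x y. cinner (S x) y"
    using assms by (rule psd_op_psd_form)
  obtain g :: "'k \<Rightarrow> 'k \<Rightarrow> complex" where g: "\<And>b. clinear_functional (g b)"
    "\<And>y z. ((\<lambda>b. g b y * cnj (g b z)) has_sum cinner (S y) z) UNIV"
    using transfinite_Cholesky by blast
  define f where "f = (\<lambda>(b, h :: 'h). if h = 0 then g b else (\<lambda>x. 0))"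
  have "clinear_functional (f i)" for i
    using g(1) by (simp add: f_def clinear_functional_def split: prod.split)
  moreover have "((\<lambda>i. f i y * cnj (f i z)) has_sum cinner (S y) z) UNIV" for y z
  proof -
    have "((\<lambda>i. f i y * cnj (f i z)) has_sum cinner (S y) z) (range (\<lambda>b. (b, 0)))"
      using g(2) by (subst has_sum_reindex) (simp_all add: inj_on_def o_def f_def)
    also have "?this \<longleftrightarrow> ?thesis"
      by (rule has_sum_cong_neutral) (auto simp: f_def)
    finally show ?thesis .
  qed
  ultimately show ?thesis
    by blast
qed


section \<open>The Riesz representation theorem\<close>

text \<open>
  The representing vector is the minimiser of \<open>\<parallel>x\<parallel>\<^sup>2 - 2 Re f(x)\<close>.  The parallelogram identity makes
  minimising sequences Cauchy, and at the minimum the directional derivatives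
  \<open>2 Re \<langle>h, z\<rangle> - 2 Re f(h)\<close> vanish.  This determines real parts only; replacing \<open>x\<close> by \<open>\<i> x\<close> gives
  the imaginary parts.
\<close>

theorem Riesz_representation:
  fixes f :: "'k::chilbert_space \<Rightarrow> complex"
  assumes lin: "clinear_functional f"
    and bounded: "\<And>x. cmod (f x) \<le> C * norm x"
  shows "\<exists>z. \<forall>x. f x = cinner x z"
proof -
  have f_add: "f (x + y) = f x + f y" and f_scaleC: "f (a *\<^sub>C x) = a * f x" for x y a
    using lin by (auto simp: clinear_functional_def)
  have blin: "bounded_linear (\<lambda>x. Re (f x))"
  proof (rule bounded_linear_intro[where K = C])
    show "norm (Re (f x)) \<le> norm x * C" for x
      using bounded[of x] abs_Re_le_cmod[of "f x"] by (simp add: mult.commute)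
  qed (simp_all add: f_add f_scaleC scaleR_scaleC)
  define J where "J x = (norm x)\<^sup>2 - 2 * Re (f x)" for x
  have midpoint: "J ((1/2) *\<^sub>R (x + y)) = J x / 2 + J y / 2 - (norm (x - y))\<^sup>2 / 4" for x y
    by (simp add: J_def f_add f_scaleC scaleR_scaleC[of "1/2"] norm_scaleC power_mult_distrib
        power2_norm_eq_inner inner_add inner_diff inner_commute[of y x] field_simps)
  have lower: "- C\<^sup>2 \<le> J x" for x
  proof -
    have "Re (f x) \<le> C * norm x"
      using bounded[of x] complex_Re_le_cmod[of "f x"] by linarith
    moreover have "0 \<le> (norm x - C)\<^sup>2"
      by simp
    ultimately show ?thesis
      by (simp add: J_def power2_diff mult.commute)
  qed
  define m where "m = Inf (range J)"
  have bdd: "bdd_below (range J)"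
    using lower by (intro bdd_belowI[of _ "- C\<^sup>2"]) auto
  have m_le: "m \<le> J x" for x
    unfolding m_def using bdd by (intro cInf_lower) auto
  have "\<exists>x. J x < m + inverse (real (Suc n))" for n
    using cInf_lessD[of "range J" "m + inverse (real (Suc n))"] by (auto simp: m_def)
  then obtain s where s: "\<And>n. J (s n) < m + inverse (real (Suc n))"
    by metis
  have "Cauchy s"
  proof (rule metric_CauchyI)
    fix e :: real
    assume "0 < e"
    then obtain N where N: "inverse (real (Suc N)) < e\<^sup>2 / 4"
      using reals_Archimedean[of "e\<^sup>2 / 4"] by auto
    have small: "J (s n) < m + e\<^sup>2 / 4" if "n \<ge> N" for n
    proof -
      have "inverse (real (Suc n)) \<le> inverse (real (Suc N))"
        using that by simp
      then show ?thesis
        using s[of n] N by linarith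
    qed
    have "dist (s n) (s k) < e" if "n \<ge> N" "k \<ge> N" for n k
    proof -
      have "(norm (s n - s k))\<^sup>2 < e\<^sup>2"
        using small[OF that(1)] small[OF that(2)] midpoint[of "s n" "s k"]
          m_le[of "(1/2) *\<^sub>R (s n + s k)"] by linarith
      then show ?thesis
        using \<open>0 < e\<close> by (simp add: dist_norm power2_less_imp_less)
    qed
    then show "\<exists>N. \<forall>n\<ge>N. \<forall>k\<ge>N. dist (s n) (s k) < e"
      by blast
  qed
  then obtain z where z: "s \<longlonglongrightarrow> z"
    by (auto simp: Cauchy_convergent_iff convergent_def)
  have "(\<lambda>n. J (s n)) \<longlonglongrightarrow> J z"
    unfolding J_def by (intro tendsto_intros z bounded_linear.tendsto[OF blin])
  moreover have "(\<lambda>n. m + inverse (real (Suc n))) \<longlonglongrightarrow> m"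
    using tendsto_add[OF tendsto_const LIMSEQ_inverse_real_of_nat] by simp
  ultimately have Jz: "J z \<le> m"
    by (rule LIMSEQ_le) (use s less_imp_le in blast)
  have Re_f: "Re (f h) = inner h z" for h
  proof -
    define d where "d = Re (f h) - inner h z"
    \<comment> \<open>The optimal step is \<open>d / \<parallel>h\<parallel>\<^sup>2\<close>; adding \<open>1\<close> to the denominator covers \<open>h = 0\<close> as well.\<close>
    define N where "N = (norm h)\<^sup>2 + 1"
    define t where "t = d / N"
    have N: "N > 0"
      by (simp add: N_def add_nonneg_pos)
    have "Re (f (t *\<^sub>R h)) = t * Re (f h)"
      by (simp add: scaleR_scaleC f_scaleC)
    moreover have "(norm (z + t *\<^sub>R h))\<^sup>2
        = (norm z)\<^sup>2 + 2 * t * inner h z + t\<^sup>2 * (norm h)\<^sup>2"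
      by (simp add: power2_norm_eq_inner inner_add inner_commute[of z h] power2_eq_square[of t]
          algebra_simps)
    ultimately have "J (z + t *\<^sub>R h) = J z - 2 * t * d + t\<^sup>2 * (norm h)\<^sup>2"
      by (simp add: J_def f_add d_def algebra_simps)
    then have "0 \<le> - 2 * t * d + t\<^sup>2 * (norm h)\<^sup>2"
      using Jz m_le[of "z + t *\<^sub>R h"] by linarith
    also have "\<dots> = - (d\<^sup>2 * (N + 1)) / N\<^sup>2"
    proof -
      have "(norm h)\<^sup>2 = N - 1"
        by (simp add: N_def)
      then show ?thesis
        using N by (simp add: t_def power2_eq_square divide_simps) (simp add: algebra_simps)
    qed
    finally have "d\<^sup>2 * (N + 1) \<le> 0"
      using N by (simp add: divide_le_0_iff zero_le_divide_iff)
    then show ?thesis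
      using N by (simp add: mult_le_0_iff d_def)
  qed
  have "f x = cinner x z" for x
  proof (rule complex_eqI)
    show "Re (f x) = Re (cinner x z)"
      by (simp add: Re_f inner_eq_Re_cinner)
    have "Re (f (\<i> *\<^sub>C x)) = Re (cinner (\<i> *\<^sub>C x) z)"
      by (simp add: Re_f inner_eq_Re_cinner)
    then show "Im (f x) = Im (cinner x z)"
      by (simp add: f_scaleC cinner_scaleC_left)
  qed
  then show ?thesis
    by blast
qed


section \<open>Square-summable families\<close>

definition ell2 :: "('i \<Rightarrow> 'a::chilbert_space) hspace"
  where "ell2 = \<lparr>carr = {x. (\<lambda>i. (norm (x i))\<^sup>2) summable_on UNIV}, hzero = (\<lambda>i. 0),
    hadd = (\<lambda>x y i. x i + y i), hscale = (\<lambda>a x i. a *\<^sub>C x i),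
    hip = (\<lambda>x y. \<Sum>\<^sub>\<infinity>i. cinner (x i) (y i))\<rparr>"

lemma ell2_simps [simp]:
  "hzero ell2 = (\<lambda>i. 0)" "hadd ell2 x y = (\<lambda>i. x i + y i)"
  "hscale ell2 a x = (\<lambda>i. a *\<^sub>C x i)" "hip ell2 x y = (\<Sum>\<^sub>\<infinity>i. cinner (x i) (y i))"
  by (simp_all add: ell2_def)

lemma ell2_carr_iff: "x \<in> carr ell2 \<longleftrightarrow> (\<lambda>i. (norm (x i))\<^sup>2) summable_on UNIV"
  by (simp add: ell2_def)

lemma hip_ell2_self: "hip ell2 x x = complex_of_real (\<Sum>\<^sub>\<infinity>i. (norm (x i))\<^sup>2)"
proof (cases "(\<lambda>i. (norm (x i))\<^sup>2) summable_on UNIV")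
  case True
  then show ?thesis
    unfolding ell2_simps cinner_self by (intro infsumI has_sum_of_real has_sum_infsum)
next
  case False
  then have "\<not> (\<lambda>i. complex_of_real ((norm (x i))\<^sup>2)) summable_on UNIV"
    using summable_on_Re by fastforce
  then show ?thesis
    using False unfolding ell2_simps cinner_self by (simp add: infsum_not_exists)
qed

lemma hnorm_ell2: "hnorm ell2 x = sqrt (\<Sum>\<^sub>\<infinity>i. (norm (x i))\<^sup>2)"
  unfolding hnorm_def hip_ell2_self by simp

lemma hnorm_ell2_square: "(hnorm ell2 x)\<^sup>2 = (\<Sum>\<^sub>\<infinity>i. (norm (x i))\<^sup>2)"
  by (simp add: hnorm_ell2 infsum_nonneg)

lemma hnorm_ell2_nonneg [simp]: "0 \<le> hnorm ell2 x"
  by (simp add: hnorm_ell2 infsum_nonneg)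

lemma hdist_ell2: "hdist ell2 x y = hnorm ell2 (\<lambda>i. x i - y i)"
  by (simp add: hdist_def scaleC_minus_one)

lemma ell2_finite_sum_le:
  assumes "x \<in> carr ell2" "finite F"
  shows "(\<Sum>i\<in>F. (norm (x i))\<^sup>2) \<le> (hnorm ell2 x)\<^sup>2"
  unfolding hnorm_ell2_square
  using assms by (intro finite_sum_le_infsum) (auto simp: ell2_carr_iff)

lemma ell2_L2_set_le:
  assumes "x \<in> carr ell2" "finite F"
  shows "L2_set (\<lambda>i. norm (x i)) F \<le> hnorm ell2 x"
  unfolding L2_set_def using ell2_finite_sum_le[OF assms] by (intro real_le_lsqrt) simp_all

lemma ell2_norm_component_le:
  assumes "x \<in> carr ell2"
  shows "norm (x i) \<le> hnorm ell2 x"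
proof (rule power2_le_imp_le)
  show "(norm (x i))\<^sup>2 \<le> (hnorm ell2 x)\<^sup>2"
    using ell2_finite_sum_le[OF assms, of "{i}"] by simp
qed simp

lemma ell2_boundI:
  assumes "\<And>F. finite F \<Longrightarrow> (\<Sum>i\<in>F. (norm (x i))\<^sup>2) \<le> c\<^sup>2" "0 \<le> c"
  shows "x \<in> carr ell2" "hnorm ell2 x \<le> c"
proof -
  note * = summable_on_if_finite_sums_bounded[of UNIV "\<lambda>i. (norm (x i))\<^sup>2", OF _ assms(1)]
  show "x \<in> carr ell2"
    unfolding ell2_carr_iff by (rule *) auto
  have "(hnorm ell2 x)\<^sup>2 \<le> c\<^sup>2"
    unfolding hnorm_ell2_square by (rule *) auto
  then show "hnorm ell2 x \<le> c"
    using assms(2) by (rule power2_le_imp_le)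
qed

lemma ell2_dominated:
  assumes x: "x \<in> carr ell2" and le: "\<And>i. norm (y i) \<le> K * norm (x i)" and K: "0 \<le> K"
  shows "y \<in> carr ell2" "hnorm ell2 y \<le> K * hnorm ell2 x"
proof -
  have "(\<Sum>i\<in>F. (norm (y i))\<^sup>2) \<le> (K * hnorm ell2 x)\<^sup>2" if "finite F" for F
  proof -
    have "(\<Sum>i\<in>F. (norm (y i))\<^sup>2) \<le> (\<Sum>i\<in>F. (K * norm (x i))\<^sup>2)"
      by (intro sum_mono power_mono le) simp
    also have "\<dots> = K\<^sup>2 * (\<Sum>i\<in>F. (norm (x i))\<^sup>2)"
      by (simp add: power_mult_distrib sum_distrib_left)
    also have "\<dots> \<le> K\<^sup>2 * (hnorm ell2 x)\<^sup>2"
      by (intro mult_left_mono ell2_finite_sum_le x that) simp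
    finally show ?thesis
      by (simp add: power_mult_distrib)
  qed
  then show "y \<in> carr ell2" "hnorm ell2 y \<le> K * hnorm ell2 x"
    using K ell2_boundI[of y "K * hnorm ell2 x"] by simp_all
qed

lemma ell2_zero_closed: "(\<lambda>i. 0) \<in> carr ell2"
  by (simp add: ell2_carr_iff)

lemma ell2_scale_closed: "x \<in> carr ell2 \<Longrightarrow> (\<lambda>i. a *\<^sub>C x i) \<in> carr ell2"
  by (erule ell2_dominated(1)[where K = "cmod a"]) (simp_all add: norm_scaleC)

lemma ell2_add_closed:
  assumes "x \<in> carr ell2" "y \<in> carr ell2"
  shows "(\<lambda>i. x i + y i) \<in> carr ell2"
proof -
  have *: "(\<Sum>i\<in>F. (norm (x i + y i))\<^sup>2) \<le> (hnorm ell2 x + hnorm ell2 y)\<^sup>2" if "finite F" for F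
  proof -
    have "(\<Sum>i\<in>F. (norm (x i + y i))\<^sup>2) \<le> (\<Sum>i\<in>F. (norm (x i) + norm (y i))\<^sup>2)"
      by (intro sum_mono power_mono norm_triangle_ineq) simp
    also have "\<dots> = (L2_set (\<lambda>i. norm (x i) + norm (y i)) F)\<^sup>2"
      by (simp add: L2_set_def sum_nonneg)
    also have "\<dots> \<le> (L2_set (\<lambda>i. norm (x i)) F + L2_set (\<lambda>i. norm (y i)) F)\<^sup>2"
      by (intro power_mono L2_set_triangle_ineq) (simp add: L2_set_nonneg)
    also have "\<dots> \<le> (hnorm ell2 x + hnorm ell2 y)\<^sup>2"
      using assms that
      by (intro power_mono[OF add_mono]) (simp_all add: ell2_L2_set_le L2_set_nonneg)
    finally show ?thesis .
  qed
  have "0 \<le> hnorm ell2 x + hnorm ell2 y"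
    by (intro add_nonneg_nonneg hnorm_ell2_nonneg)
  with * show ?thesis
    by (rule ell2_boundI)
qed

lemma ell2_diff_closed:
  assumes "x \<in> carr ell2" "y \<in> carr ell2"
  shows "(\<lambda>i. x i - y i) \<in> carr ell2"
  using ell2_add_closed[OF assms(1) ell2_scale_closed[OF assms(2), of "-1"]]
  by (simp add: scaleC_minus_one)

lemma ell2_Cauchy_Schwarz:
  assumes "x \<in> carr ell2" "y \<in> carr ell2"
  shows "(\<lambda>i. cinner (x i) (y i)) summable_on UNIV"
    and "cmod (hip ell2 x y) \<le> hnorm ell2 x * hnorm ell2 y"
proof -
  have le: "(\<Sum>i\<in>F. cmod (cinner (x i) (y i))) \<le> hnorm ell2 x * hnorm ell2 y" if "finite F" for F
  proof -
    have "(\<Sum>i\<in>F. cmod (cinner (x i) (y i))) \<le> (\<Sum>i\<in>F. \<bar>norm (x i)\<bar> * \<bar>norm (y i)\<bar>)"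
      by (intro sum_mono) (simp add: cmod_cinner_le)
    also have "\<dots> \<le> L2_set (\<lambda>i. norm (x i)) F * L2_set (\<lambda>i. norm (y i)) F"
      by (rule L2_set_mult_ineq)
    also have "\<dots> \<le> hnorm ell2 x * hnorm ell2 y"
      using assms that by (intro mult_mono ell2_L2_set_le L2_set_nonneg hnorm_ell2_nonneg)
    finally show ?thesis .
  qed
  note * = summable_on_if_finite_sums_bounded[of UNIV "\<lambda>i. cmod (cinner (x i) (y i))", OF _ le]
  have abs: "(\<lambda>i. cmod (cinner (x i) (y i))) summable_on UNIV"
    by (rule *) auto
  then show "(\<lambda>i. cinner (x i) (y i)) summable_on UNIV"
    by (rule abs_summable_summable)
  show "cmod (hip ell2 x y) \<le> hnorm ell2 x * hnorm ell2 y"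
    using norm_infsum_bound[OF abs] *(2) by simp
qed

text \<open>
  A Cauchy sequence converges in each coordinate.  The estimate for \<open>s n - s m\<close> on a finite set of
  coordinates passes to the limit in \<open>m\<close>, uniformly in the finite set; this shows both that the
  pointwise limit is square-summable and that it is approached in norm.
\<close>

lemma ell2_complete:
  fixes s :: "nat \<Rightarrow> 'i \<Rightarrow> 'a::chilbert_space"
  assumes s: "\<And>n. s n \<in> carr ell2"
    and Cauchy: "\<forall>e>0. \<exists>N. \<forall>m\<ge>N. \<forall>n\<ge>N. hdist ell2 (s m) (s n) < e"
  shows "\<exists>l\<in>carr ell2. (\<lambda>n. hdist ell2 (s n) l) \<longlonglongrightarrow> 0"
proof -
  have "Cauchy (\<lambda>n. s n i)" for i
  proof (rule metric_CauchyI)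
    fix e :: real
    assume "0 < e"
    then obtain N where "\<forall>m\<ge>N. \<forall>n\<ge>N. hdist ell2 (s m) (s n) < e"
      using Cauchy by blast
    moreover have "dist (s m i) (s n i) \<le> hdist ell2 (s m) (s n)" for m n
      using ell2_norm_component_le[OF ell2_diff_closed[OF s[of m] s[of n]], of i]
      by (simp add: dist_norm hdist_ell2)
    ultimately show "\<exists>N. \<forall>m\<ge>N. \<forall>n\<ge>N. dist (s m i) (s n i) < e"
      by (meson le_less_trans)
  qed
  then have "\<forall>i. \<exists>l. (\<lambda>n. s n i) \<longlonglongrightarrow> l"
    by (simp add: Cauchy_convergent_iff convergent_def)
  then obtain l where l: "\<And>i. (\<lambda>n. s n i) \<longlonglongrightarrow> l i"
    by metis
  have close: "\<exists>N. \<forall>n\<ge>N. (\<lambda>i. s n i - l i) \<in> carr ell2 \<and> hdist ell2 (s n) l \<le> e"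
    if "0 < e" for e
  proof -
    obtain N where N: "\<And>m n. m \<ge> N \<Longrightarrow> n \<ge> N \<Longrightarrow> hdist ell2 (s m) (s n) < e"
      using Cauchy \<open>0 < e\<close> by blast
    have "(\<Sum>i\<in>F. (norm (s n i - l i))\<^sup>2) \<le> e\<^sup>2" if "n \<ge> N" "finite F" for n F
    proof (rule LIMSEQ_le_const2)
      show "(\<lambda>m. \<Sum>i\<in>F. (norm (s n i - s m i))\<^sup>2) \<longlonglongrightarrow> (\<Sum>i\<in>F. (norm (s n i - l i))\<^sup>2)"
        by (intro tendsto_intros l)
      have "(\<Sum>i\<in>F. (norm (s n i - s m i))\<^sup>2) \<le> e\<^sup>2" if "m \<ge> N" for m
      proof -
        have "(\<Sum>i\<in>F. (norm (s n i - s m i))\<^sup>2) \<le> (hdist ell2 (s n) (s m))\<^sup>2"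
          unfolding hdist_ell2 by (intro ell2_finite_sum_le ell2_diff_closed s \<open>finite F\<close>)
        also have "\<dots> \<le> e\<^sup>2"
          using N[OF \<open>n \<ge> N\<close> \<open>m \<ge> N\<close>] by (intro power_mono) (simp_all add: hdist_ell2)
        finally show ?thesis .
      qed
      then show "\<exists>N. \<forall>m\<ge>N. (\<Sum>i\<in>F. (norm (s n i - s m i))\<^sup>2) \<le> e\<^sup>2"
        by blast
    qed
    from ell2_boundI[OF this less_imp_le[OF \<open>0 < e\<close>]] show ?thesis
      unfolding hdist_ell2 by blast
  qed
  show ?thesis
  proof (intro bexI)
    obtain N where "(\<lambda>i. s N i - l i) \<in> carr ell2"
      using close[of 1] by auto
    from ell2_diff_closed[OF s[of N] this] show "l \<in> carr ell2"
      by simp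
    show "(\<lambda>n. hdist ell2 (s n) l) \<longlonglongrightarrow> 0"
    proof (rule LIMSEQ_I)
      fix e :: real
      assume "0 < e"
      then obtain N where N: "\<forall>n\<ge>N. hdist ell2 (s n) l \<le> e / 2"
        using close[of "e / 2"] by auto
      have "norm (hdist ell2 (s n) l - 0) < e" if "n \<ge> N" for n
      proof -
        have "0 \<le> hdist ell2 (s n) l"
          by (simp add: hdist_ell2)
        moreover have "hdist ell2 (s n) l \<le> e / 2"
          using N that by blast
        ultimately show ?thesis
          using \<open>0 < e\<close> by simp
      qed
      then show "\<exists>N. \<forall>n\<ge>N. norm (hdist ell2 (s n) l - 0) < e"
        by blast
    qed
  qed
qed

theorem hilbert_space_ell2: "hilbert_space (ell2 :: ('i \<Rightarrow> 'a::chilbert_space) hspace)"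
proof
  show "\<exists>l\<in>carr ell2. (\<lambda>n. hdist ell2 (s n) l) \<longlonglongrightarrow> 0"
    if "\<And>n. s n \<in> carr ell2"
      "\<forall>e>0. \<exists>N. \<forall>m\<ge>N. \<forall>n\<ge>N. hdist ell2 (s m) (s n) < e"
    for s :: "nat \<Rightarrow> 'i \<Rightarrow> 'a"
    using that by (rule ell2_complete)
  fix x y z :: "'i \<Rightarrow> 'a" and a b :: complex
  assume x: "x \<in> carr ell2"
  show "\<exists>y\<in>carr ell2. hadd ell2 x y = hzero ell2"
    using ell2_scale_closed[OF x, of "-1"]
    by (intro bexI[of _ "\<lambda>i. (-1) *\<^sub>C x i"]) (simp_all add: scaleC_minus_one)
  show "0 < Re (hip ell2 x x)" if ne: "x \<noteq> hzero ell2"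
  proof -
    obtain i where "x i \<noteq> 0"
      using ne by (auto simp: fun_eq_iff)
    then have "0 < hnorm ell2 x"
      using ell2_norm_component_le[OF x, of i] by (meson less_le_trans zero_less_norm_iff)
    then show ?thesis
      by (simp add: hnorm_def del: ell2_simps)
  qed
  assume y: "y \<in> carr ell2"
  show "hip ell2 x y = cnj (hip ell2 y x)"
    unfolding ell2_simps infsum_cnj[symmetric] by (intro infsum_cong cinner_commute)
  show "hip ell2 (hscale ell2 a x) y = a * hip ell2 x y"
    unfolding ell2_simps cinner_scaleC_left by (intro infsum_cmult_right ell2_Cauchy_Schwarz x y)
  assume z: "z \<in> carr ell2"
  show "hip ell2 (hadd ell2 x y) z = hip ell2 x z + hip ell2 y z"
    unfolding ell2_simps cinner_add_left by (intro infsum_add ell2_Cauchy_Schwarz x y z)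
next
  fix x y z :: "'i \<Rightarrow> 'a" and a b :: complex
  show "hzero ell2 \<in> carr (ell2 :: ('i \<Rightarrow> 'a) hspace)"
    by (simp add: ell2_zero_closed)
  show "hadd ell2 x y \<in> carr ell2" if "x \<in> carr ell2" "y \<in> carr ell2"
    using that by (simp add: ell2_add_closed)
  show "hscale ell2 a x \<in> carr ell2" if "x \<in> carr ell2"
    using that by (simp add: ell2_scale_closed)
qed (simp_all add: fun_eq_iff add_ac scaleC_add_right scaleC_add_left scaleC_scaleC)

text \<open>For each \<open>t\<close> the functional \<open>x \<mapsto> \<langle>V x, t\<rangle>\<close> is bounded, and \<open>V\<^sup>* t\<close> is its Riesz vector.\<close>

lemma adjoint_exists_ell2:
  fixes V :: "'k::chilbert_space \<Rightarrow> 'i \<Rightarrow> 'a::chilbert_space"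
  assumes V: "bounded_op type_space ell2 V"
  shows "\<exists>V'. adjoint_op type_space ell2 V V'"
proof -
  interpret hilbert_space "ell2 :: ('i \<Rightarrow> 'a) hspace"
    by (rule hilbert_space_ell2)
  from V have V_carr: "V x \<in> carr ell2" and V_add: "V (x + y) = hadd ell2 (V x) (V y)"
    and V_scale: "V (a *\<^sub>C x) = hscale ell2 a (V x)" for x y a
    by (simp_all add: bounded_op_def del: ell2_simps)
  obtain C where "\<And>x. hnorm ell2 (V x) \<le> C * norm x"
    using V by (auto simp: bounded_op_def)
  then have C: "hnorm ell2 (V x) \<le> \<bar>C\<bar> * norm x" for x
    by (meson abs_ge_self mult_right_mono norm_ge_zero order_trans)
  have hip_V: "cmod (hip ell2 (V x) t) \<le> \<bar>C\<bar> * hnorm ell2 t * norm x" if "t \<in> carr ell2" for x t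
  proof -
    have "cmod (hip ell2 (V x) t) \<le> hnorm ell2 (V x) * hnorm ell2 t"
      by (rule ell2_Cauchy_Schwarz(2)[OF V_carr that])
    also have "\<dots> \<le> \<bar>C\<bar> * norm x * hnorm ell2 t"
      by (intro mult_right_mono C) simp
    finally show ?thesis
      by (simp add: mult_ac del: ell2_simps)
  qed
  have "\<exists>z. \<forall>x. hip ell2 (V x) t = cinner x z" if "t \<in> carr ell2" for t
  proof (rule Riesz_representation[OF _ hip_V[OF that]])
    show "clinear_functional (\<lambda>x. hip ell2 (V x) t)"
      unfolding clinear_functional_def
      by (simp add: V_add V_scale ip_add_left ip_scale_left V_carr that del: ell2_simps)
  qed
  then obtain V' where V': "\<And>t x. t \<in> carr ell2 \<Longrightarrow> hip ell2 (V x) t = cinner x (V' t)"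
    by metis
  have "bounded_op ell2 type_space V'"
    unfolding bounded_op_def type_space_simps
  proof (intro conjI ballI allI)
    fix s t a
    assume s: "s \<in> carr (ell2 :: ('i \<Rightarrow> 'a) hspace)"
    show "V' (hscale ell2 a s) = a *\<^sub>C V' s"
    proof (rule cinner_extensionality)
      fix x
      have "cinner x (V' (hscale ell2 a s)) = cnj (hip ell2 (hscale ell2 a s) (V x))"
        unfolding V'[OF scale_closed[OF s], symmetric]
        by (rule ip_commute[OF V_carr scale_closed[OF s]])
      also have "\<dots> = cnj a * hip ell2 (V x) s"
        unfolding ip_scale_left[OF s V_carr] complex_cnj_mult
        by (simp only: ip_commute[OF V_carr s, symmetric])
      finally show "cinner x (V' (hscale ell2 a s)) = cinner x (a *\<^sub>C V' s)"
        by (simp add: V' s cinner_scaleC_right del: ell2_simps)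
    qed
    assume t: "t \<in> carr (ell2 :: ('i \<Rightarrow> 'a) hspace)"
    show "V' (hadd ell2 s t) = V' s + V' t"
    proof (rule cinner_extensionality)
      fix x
      have "cinner x (V' (hadd ell2 s t)) = cnj (hip ell2 (hadd ell2 s t) (V x))"
        unfolding V'[OF add_closed[OF s t], symmetric]
        by (rule ip_commute[OF V_carr add_closed[OF s t]])
      also have "\<dots> = hip ell2 (V x) s + hip ell2 (V x) t"
        unfolding ip_add_left[OF s t V_carr] complex_cnj_add
        by (simp only: ip_commute[OF V_carr s, symmetric] ip_commute[OF V_carr t, symmetric])
      finally show "cinner x (V' (hadd ell2 s t)) = cinner x (V' s + V' t)"
        by (simp add: V' s t cinner_add_right del: ell2_simps)
    qed
  next
    have "norm (V' t) \<le> \<bar>C\<bar> * hnorm ell2 t" if t: "t \<in> carr ell2" for t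
    proof (cases "V' t = 0")
      case False
      have "norm (V' t) * norm (V' t) = cmod (cinner (V' t) (V' t))"
        by (simp add: cinner_self norm_power power2_eq_square norm_mult)
      also have "\<dots> \<le> \<bar>C\<bar> * hnorm ell2 t * norm (V' t)"
        using hip_V[OF t, of "V' t"] by (simp add: V' t del: ell2_simps)
      finally show ?thesis
        using False by simp
    qed simp
    then show "\<exists>C. \<forall>t\<in>carr ell2. hnorm type_space (V' t) \<le> C * hnorm ell2 t"
      by auto
  qed simp
  then show ?thesis
    using V' by (auto simp: adjoint_op_def simp del: ell2_simps)
qed


section \<open>Tensor products with square-summable sequences\<close>

definition ell2_tensor :: "('i \<Rightarrow> complex) \<Rightarrow> 'h::chilbert_space \<Rightarrow> 'i \<Rightarrow> 'h"
  where "ell2_tensor l h = (\<lambda>i. l i *\<^sub>C h)"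

lemma hsum_ell2: "hsum ell2 f n = (\<lambda>i. \<Sum>k<n. f k i)"
  by (induction n) simp_all

text \<open>
  Cut off \<open>t\<close> outside a finite set \<open>F\<close> that carries almost all of its norm; the remaining family is the
  finite sum of the elementary tensors \<open>\<delta>\<^sub>i \<otimes> t i\<close> with \<open>i \<in> F\<close>.
\<close>

lemma ell2_tensor_dense:
  fixes t :: "'i \<Rightarrow> 'h::chilbert_space"
  assumes t: "t \<in> carr ell2" and e: "0 < e"
  shows "\<exists>n l h. (\<forall>k<n. l k \<in> carr ell2) \<and>
    hdist ell2 t (hsum ell2 (\<lambda>k. ell2_tensor (l k) (h k)) n) < e"
proof -
  let ?f = "\<lambda>i. (norm (t i))\<^sup>2"
  have sm: "?f summable_on UNIV"
    using t by (simp add: ell2_carr_iff)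
  have "\<exists>F. finite F \<and> F \<subseteq> UNIV \<and> dist (sum ?f F) (infsum ?f UNIV) \<le> (e / 2)\<^sup>2"
    using sm e by (intro has_sum_finite_approximation has_sum_infsum) auto
  then obtain F where F: "finite F" and "dist (sum ?f F) (infsum ?f UNIV) \<le> (e / 2)\<^sup>2"
    by blast
  then have le: "infsum ?f UNIV - sum ?f F \<le> (e / 2)\<^sup>2"
    by (simp add: dist_real_def)
  obtain \<phi> where \<phi>: "bij_betw \<phi> {..<card F} F"
    using ex_bij_betw_nat_finite[OF F] by (auto simp: atLeast0LessThan)
  define l where "l k = (\<lambda>i. if i = \<phi> k then 1 else 0 :: complex)" for k
  have l: "l k \<in> carr ell2" for k
    unfolding ell2_carr_iff
    by (rule summable_on_cong_neutral[THEN iffD1, OF _ _ _ summable_on_finite[of "{\<phi> k}"]])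
      (auto simp: l_def)
  let ?r = "\<lambda>i. if i \<in> F then 0 else t i"
  have "(\<Sum>k<card F. ell2_tensor (l k) (t (\<phi> k)) i) = (if i \<in> F then t i else 0)" for i
  proof -
    have "(\<Sum>k<card F. ell2_tensor (l k) (t (\<phi> k)) i) = (\<Sum>k<card F. if i = \<phi> k then t (\<phi> k) else 0)"
      by (intro sum.cong) (simp_all add: ell2_tensor_def l_def)
    also have "\<dots> = (\<Sum>j\<in>F. if i = j then t j else 0)"
      by (rule sum.reindex_bij_betw[OF \<phi>])
    finally show ?thesis
      using F by simp
  qed
  then have "(\<lambda>i. t i - (\<Sum>k<card F. ell2_tensor (l k) (t (\<phi> k)) i)) = ?r"
    by auto
  then have eq: "hdist ell2 t (hsum ell2 (\<lambda>k. ell2_tensor (l k) (t (\<phi> k))) (card F)) = hnorm ell2 ?r"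
    by (simp add: hdist_ell2 hsum_ell2)
  have "(\<Sum>i\<in>G. (norm (?r i))\<^sup>2) \<le> (e / 2)\<^sup>2" if G: "finite G" for G
  proof -
    have "(\<Sum>i\<in>G. (norm (?r i))\<^sup>2) = sum ?f (G - F)"
      using G by (intro sum.mono_neutral_cong_right) auto
    also have "\<dots> = sum ?f (G \<union> F) - sum ?f F"
      using G F by (subst sum_diff[symmetric]) (auto intro: sum.cong)
    also have "\<dots> \<le> infsum ?f UNIV - sum ?f F"
      using G F sm by (intro diff_right_mono finite_sum_le_infsum) auto
    finally show ?thesis
      using le by linarith
  qed
  then have "hnorm ell2 ?r \<le> e / 2"
    using e by (intro ell2_boundI) auto
  then show ?thesis
    using e l eq by (intro exI[of _ "card F"] exI[of _ l] exI[of _ "\<lambda>k. t (\<phi> k)"]) auto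
qed

theorem hilbert_tensor_ell2:
  "hilbert_tensor (ell2 :: ('i \<Rightarrow> complex) hspace) (type_space :: 'h::chilbert_space hspace)
     ell2 ell2_tensor"
  unfolding hilbert_tensor_def type_space_simps
proof (intro conjI ballI allI impI)
  fix l l' :: "'i \<Rightarrow> complex" and h h' :: 'h
  assume l: "l \<in> carr ell2"
  show "ell2_tensor l h \<in> carr ell2"
    by (rule ell2_dominated[OF l, where K = "norm h"])
      (auto simp: ell2_tensor_def norm_scaleC mult.commute)
  assume l': "l' \<in> carr ell2"
  have "(\<Sum>\<^sub>\<infinity>i. cinner (l i) (l' i) * cinner h h') = (\<Sum>\<^sub>\<infinity>i. cinner (l i) (l' i)) * cinner h h'"
    by (intro infsum_cmult_left ell2_Cauchy_Schwarz l l')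
  then show "hip ell2 (ell2_tensor l h) (ell2_tensor l' h') = hip ell2 l l' * cinner h h'"
    by (simp add: ell2_tensor_def cinner_scaleC_left cinner_scaleC_right cinner_complex_def mult_ac)
next
  fix t :: "'i \<Rightarrow> 'h" and e :: real
  assume "t \<in> carr ell2" "0 < e"
  then show "\<exists>n l h. (\<forall>i<n. l i \<in> carr ell2 \<and> h i \<in> UNIV) \<and>
    hdist ell2 t (hsum ell2 (\<lambda>i. ell2_tensor (l i) (h i)) n) < e"
    using ell2_tensor_dense by simp
next
  fix l l' :: "'i \<Rightarrow> complex" and h h' :: 'h and a :: complex
  show "ell2_tensor (hadd ell2 l l') h = hadd ell2 (ell2_tensor l h) (ell2_tensor l' h)"
    by (simp add: ell2_tensor_def scaleC_add_left)
  show "ell2_tensor l (h + h') = hadd ell2 (ell2_tensor l h) (ell2_tensor l h')"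
    by (simp add: ell2_tensor_def scaleC_add_right)
  show "ell2_tensor (hscale ell2 a l) h = hscale ell2 a (ell2_tensor l h)"
    by (simp add: ell2_tensor_def scaleC_scaleC scaleC_complex_def)
  show "ell2_tensor l (a *\<^sub>C h) = hscale ell2 a (ell2_tensor l h)"
    by (simp add: ell2_tensor_def scaleC_scaleC mult.commute)
qed (rule hilbert_space_ell2)

lemma ampliation_ell2:
  fixes S :: "'h::chilbert_space \<Rightarrow> 'h"
  assumes "bounded_clinear S"
  shows "ampliation ell2 type_space ell2 ell2_tensor S (\<lambda>t i. S (t i))"
proof -
  interpret S: bounded_linear S
    using assms by (simp add: bounded_clinear_def)
  have S_scaleC: "S (a *\<^sub>C x) = a *\<^sub>C S x" for a x
    using assms by (simp add: bounded_clinear_def)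
  obtain K where K: "0 \<le> K" "\<And>x. norm (S x) \<le> K * norm x"
    using S.nonneg_bounded by (metis mult.commute)
  have "bounded_op ell2 ell2 (\<lambda>t i. S (t i))"
    unfolding bounded_op_def using ell2_dominated[OF _ K(2) K(1)]
    by (auto simp: S.add S_scaleC)
  then show ?thesis
    by (simp add: ampliation_def ell2_tensor_def S_scaleC)
qed


section \<open>A joint dilation from orthonormal eigenvectors\<close>

lemma has_sum_sum:
  fixes f :: "'v \<Rightarrow> 'i \<Rightarrow> 'a::topological_comm_monoid_add"
  assumes "\<And>v. v \<in> F \<Longrightarrow> (f v has_sum s v) A"
  shows "((\<lambda>i. \<Sum>v\<in>F. f v i) has_sum (\<Sum>v\<in>F. s v)) A"
  using assms by (induction F rule: infinite_finite_induct) (simp_all add: has_sum_add)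

text \<open>
  The isometry is \<open>V x = \<Sum>\<^sub>v R\<^sub>v x \<otimes> e\<^sub>v\<close> with \<open>Q\<^sub>v = R\<^sub>v\<^sup>* R\<^sub>v\<close>, where \<open>f v i x\<close> is the coordinate of
  \<open>R\<^sub>v x\<close> at the index \<open>i\<close>.  All requirements on \<open>V\<close> are instances of the single identity
  \<open>\<langle>V y, \<Sum>\<^sub>v s\<^sub>v R\<^sub>v x \<otimes> e\<^sub>v\<rangle> = \<langle>y, \<Sum>\<^sub>v s\<^sub>v Q\<^sub>v x\<rangle>\<close>: with \<open>s = 1\<close> it says that \<open>V\<close> is isometric, and with
  the eigenvalues \<open>s\<^sub>v = d\<^sub>j\<^sub>v\<close> that \<open>V\<^sup>* (I \<otimes> H\<^sub>j) V = B\<^sub>j\<close>.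
\<close>

theorem has_joint_dilation_from_joint_eigenvectors:
  fixes H :: "'m \<Rightarrow> 'h::chilbert_space \<Rightarrow> 'h" and B :: "'m \<Rightarrow> 'k::chilbert_space \<Rightarrow> 'k"
    and C :: "'s set"
  assumes C: "finite C"
    and H: "\<And>j. bounded_clinear (H j)"
    and e: "\<And>v w. v \<in> C \<Longrightarrow> w \<in> C \<Longrightarrow> cinner (e v) (e w) = (if v = w then 1 else 0)"
    and He: "\<And>j v. v \<in> C \<Longrightarrow> H j (e v) = d j v *\<^sub>C e v"
    and Q: "\<And>v. v \<in> C \<Longrightarrow> bounded_clinear (Q v)" "\<And>v. v \<in> C \<Longrightarrow> psd_op (Q v)"
    and Q_sum: "\<And>x. (\<Sum>v\<in>C. Q v x) = x"
    and B: "\<And>j x. B j x = (\<Sum>v\<in>C. d j v *\<^sub>C Q v x)"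
  shows "has_joint_dilation H B"
proof -
  have "\<exists>f :: 'k \<times> 'h \<Rightarrow> 'k \<Rightarrow> complex. (\<forall>i. clinear_functional (f i)) \<and>
    (\<forall>y z. ((\<lambda>i. f i y * cnj (f i z)) has_sum cinner (Q v y) z) UNIV)" if "v \<in> C" for v
    using Q that by (intro psd_op_sum_of_rank_one) auto
  then obtain f :: "'s \<Rightarrow> 'k \<times> 'h \<Rightarrow> 'k \<Rightarrow> complex"
    where f: "\<And>v i. v \<in> C \<Longrightarrow> clinear_functional (f v i)"
      and f_sum: "\<And>v y z. v \<in> C \<Longrightarrow>
        ((\<lambda>i. f v i y * cnj (f v i z)) has_sum cinner (Q v y) z) UNIV"
    by metis
  define V where "V x i = (\<Sum>v\<in>C. f v i x *\<^sub>C e v)" for x i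
  have V_inner: "((\<lambda>i. cinner (V y i) (\<Sum>v\<in>C. (s v * f v i x) *\<^sub>C e v))
      has_sum cinner y (\<Sum>v\<in>C. s v *\<^sub>C Q v x)) UNIV" for x y s
  proof -
    have 1: "cinner (V y i) (\<Sum>v\<in>C. (s v * f v i x) *\<^sub>C e v)
        = (\<Sum>v\<in>C. cnj (s v) * (f v i y * cnj (f v i x)))" for i
    proof -
      have "cinner (V y i) (\<Sum>v\<in>C. (s v * f v i x) *\<^sub>C e v)
          = (\<Sum>v\<in>C. \<Sum>w\<in>C. cinner (f w i y *\<^sub>C e w) ((s v * f v i x) *\<^sub>C e v))"
        by (simp only: V_def cinner_sum_left cinner_sum_right)
      also have "\<dots> = (\<Sum>v\<in>C. \<Sum>w\<in>C. if v = w then cnj (s v) * (f w i y * cnj (f v i x)) else 0)"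
        by (intro sum.cong refl) (simp add: e cinner_scaleC_left cinner_scaleC_right)
      finally have "cinner (V y i) (\<Sum>v\<in>C. (s v * f v i x) *\<^sub>C e v)
          = (\<Sum>v\<in>C. \<Sum>w\<in>C. if v = w then cnj (s v) * (f w i y * cnj (f v i x)) else 0)" .
      then show ?thesis
        using C by simp
    qed
    have 2: "cinner y (\<Sum>v\<in>C. s v *\<^sub>C Q v x) = (\<Sum>v\<in>C. cnj (s v) * cinner (Q v y) x)"
      unfolding cinner_sum_right cinner_scaleC_right
      using psd_op_symmetric[OF Q] by (intro sum.cong) auto
    show ?thesis
      unfolding 1 2 by (intro has_sum_sum has_sum_cmult_right f_sum)
  qed
  have V_norm: "((\<lambda>i. (norm (V x i))\<^sup>2) has_sum (norm x)\<^sup>2) UNIV" for x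
  proof -
    have "((\<lambda>i. cinner (V x i) (V x i)) has_sum cinner x x) UNIV"
      using V_inner[of x "\<lambda>_. 1" x] by (simp add: Q_sum flip: V_def)
    then have "((\<lambda>i. Re (cinner (V x i) (V x i))) has_sum Re (cinner x x)) UNIV"
      by (rule has_sum_Re)
    then show ?thesis
      by (simp add: cinner_self)
  qed
  have V_carr: "V x \<in> carr ell2" for x
    using V_norm[of x] by (auto simp: ell2_carr_iff has_sum_imp_summable)
  have V_isometric: "hnorm ell2 (V x) = norm x" for x
    unfolding hnorm_ell2 infsumI[OF V_norm] by simp
  have f_linear: "f v i (x + y) = f v i x + f v i y" "f v i (a *\<^sub>C x) = a * f v i x"
    if "v \<in> C" for v i x y a
    using f[OF that] by (simp_all add: clinear_functional_def)
  have V_bounded: "bounded_op type_space ell2 V"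
    unfolding bounded_op_def
  proof (intro conjI ballI allI)
    show "V (hadd type_space x y) = hadd ell2 (V x) (V y)" for x y
      by (simp add: fun_eq_iff V_def f_linear scaleC_add_left sum.distrib)
    show "V (hscale type_space a x) = hscale ell2 a (V x)" for a x
      by (simp add: fun_eq_iff V_def f_linear scaleC_sum_right scaleC_scaleC)
    show "\<exists>C. \<forall>x\<in>carr type_space. hnorm ell2 (V x) \<le> C * hnorm type_space x"
      by (intro exI[of _ 1]) (simp add: V_isometric)
  qed (rule V_carr)
  then obtain V' where V': "adjoint_op type_space ell2 V V'"
    using adjoint_exists_ell2 by blast
  have V'_eqI: "V' t = z" if "t \<in> carr ell2" "\<And>y. hip ell2 (V y) t = cinner y z" for t z
  proof (rule cinner_extensionality)
    show "cinner y (V' t) = cinner y z" for y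
      using V' that by (simp add: adjoint_op_def del: ell2_simps)
  qed
  have amp: "ampliation ell2 type_space ell2 ell2_tensor (H j) (\<lambda>t i. H j (t i))" for j
    by (rule ampliation_ell2[OF H])
  have HV: "(\<lambda>i. H j (V x i)) = (\<lambda>i. \<Sum>v\<in>C. (d j v * f v i x) *\<^sub>C e v)" for j x
    unfolding V_def bounded_clinear_sum[OF H] bounded_clinear_scaleC[OF H]
    by (simp add: He scaleC_scaleC mult.commute)
  have "V' (V x) = x" for x
  proof (rule V'_eqI[OF V_carr])
    show "hip ell2 (V y) (V x) = cinner y x" for y
      using infsumI[OF V_inner[of y "\<lambda>_. 1" x]] by (simp add: Q_sum flip: V_def)
  qed
  moreover have "V' (\<lambda>i. H j (V x i)) = B j x" for j x
  proof (rule V'_eqI)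
    show "(\<lambda>i. H j (V x i)) \<in> carr ell2"
      using amp[of j] V_carr[of x] by (auto simp: ampliation_def bounded_op_def)
    show "hip ell2 (V y) (\<lambda>i. H j (V x i)) = cinner y (B j x)" for y
      unfolding HV B ell2_simps by (rule infsumI[OF V_inner])
  qed
  ultimately show ?thesis
    unfolding has_joint_dilation_def
    using hilbert_space_ell2 hilbert_tensor_ell2 V_bounded V' amp
    by (intro exI[of _ ell2] exI[of _ ell2_tensor] exI[of _ V] exI[of _ V']
        exI[of _ "\<lambda>j t i. H j (t i)"]) blast
qed


section \<open>Barycentric coordinates\<close>

text \<open>
  The coordinate of a point \<open>x\<close> at the vertex \<open>v\<close> is \<open>a v + \<Sum>\<^sub>j c v j x\<^sub>j\<close>.  The coefficients are
  kept explicit, rather than the affine function, because they will be applied to operators in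
  place of the \<open>x\<^sub>j\<close>.
\<close>

locale barycentric =
  fixes C :: "(real ^ 'm::finite) set"
    and a :: "real ^ 'm \<Rightarrow> real" and c :: "real ^ 'm \<Rightarrow> 'm \<Rightarrow> real"
  assumes finite: "finite C"
    and coordinate_vertex: "\<lbrakk>v \<in> C; w \<in> C\<rbrakk> \<Longrightarrow>
      a v + (\<Sum>j\<in>UNIV. c v j * w $ j) = (if v = w then 1 else 0)"
    and coordinates_sum_one: "(\<Sum>v\<in>C. a v + (\<Sum>j\<in>UNIV. c v j * x $ j)) = 1"
    and coordinates_reproduce: "(\<Sum>v\<in>C. (a v + (\<Sum>j\<in>UNIV. c v j * x $ j)) * v $ k) = x $ k"

text \<open>
  By affine independence the differences \<open>w - v\<close> with \<open>w \<noteq> v\<close> are linearly independent, so a linear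
  functional \<open>g\<close> takes the value \<open>-1\<close> on all of them, and \<open>x \<mapsto> 1 + g (x - v)\<close> is the coordinate at
  \<open>v\<close>.  The cardinality makes every point an affine combination of the vertices, which extends the
  identities from the vertices to the whole space.
\<close>

lemma barycentric_exists:
  fixes C :: "(real ^ 'm::finite) set"
  assumes indep: "\<not> affine_dependent C" and card: "int (card C) = int CARD('m) + 1"
  shows "\<exists>a c. barycentric C a c"
proof -
  have fin: "finite C"
    using indep by (rule aff_independent_finite)
  have full: "affine hull C = UNIV"
    using aff_dim_affine_independent[OF indep] card by (intro affine_hull_UNIV) simp
  have "\<exists>g. linear g \<and> (\<forall>w\<in>C. w \<noteq> v \<longrightarrow> g (w - v) = (-1 :: real))" if v: "v \<in> C" for v
  proof -
    have "independent ((\<lambda>x. - v + x) ` (C - {v}))"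
      using indep affine_dependent_iff_dependent2[OF v] by simp
    then obtain g where "linear g" "\<forall>x\<in>(\<lambda>x. - v + x) ` (C - {v}). g x = (-1 :: real)"
      using linear_independent_extend[of _ "\<lambda>_. -1"] by blast
    then show ?thesis
      by (intro exI[of _ g]) auto
  qed
  then obtain g where g: "\<And>v. v \<in> C \<Longrightarrow> linear (g v)"
    and gw: "\<And>v w. v \<in> C \<Longrightarrow> w \<in> C \<Longrightarrow> w \<noteq> v \<Longrightarrow> g v (w - v) = (-1 :: real)"
    by metis
  define a where "a v = 1 - g v v" for v
  define c where "c v j = g v (axis j 1)" for v j
  define lam where "lam v x = a v + (\<Sum>j\<in>UNIV. c v j * x $ j)" for v x
  have lam: "lam v x = 1 + g v (x - v)" if "v \<in> C" for v x
  proof -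
    have "g v x = g v (\<Sum>j\<in>UNIV. (x $ j) *\<^sub>R axis j 1)"
      using basis_expansion[of x] by (simp add: scalar_mult_eq_scaleR)
    also have "\<dots> = (\<Sum>j\<in>UNIV. c v j * x $ j)"
      by (simp add: linear_sum[OF g[OF that]] linear_cmul[OF g[OF that]] c_def mult.commute)
    finally show ?thesis
      by (simp add: lam_def a_def linear_diff[OF g[OF that]])
  qed
  have vertex: "lam v w = (if v = w then 1 else 0)" if "v \<in> C" "w \<in> C" for v w
    using gw[of v w] that linear_0[OF g[OF that(1)]] by (cases "v = w") (simp_all add: lam)
  have coord: "lam v (\<Sum>w\<in>C. t w *\<^sub>R w) = t v" if v: "v \<in> C" and t: "sum t C = 1" for v t
  proof -
    have "(\<Sum>j\<in>UNIV. c v j * (\<Sum>w\<in>C. t w *\<^sub>R w) $ j) = (\<Sum>w\<in>C. t w * (\<Sum>j\<in>UNIV. c v j * w $ j))"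
      unfolding sum_component sum_distrib_left
      by (subst sum.swap) (simp add: mult_ac)
    then have "lam v (\<Sum>w\<in>C. t w *\<^sub>R w) = (\<Sum>w\<in>C. t w * lam v w)"
      using t by (simp add: lam_def distrib_left sum.distrib flip: sum_distrib_right)
    also have "\<dots> = (\<Sum>w\<in>C. if v = w then t w else 0)"
      using v by (intro sum.cong) (simp_all add: vertex)
    finally show ?thesis
      using fin v by simp
  qed
  have expand: "(\<Sum>v\<in>C. lam v x) = 1 \<and> (\<Sum>v\<in>C. lam v x * v $ k) = x $ k" for x k
  proof -
    obtain t where t: "sum t C = 1" and x: "(\<Sum>w\<in>C. t w *\<^sub>R w) = x"
      using full affine_hull_finite[OF fin] by blast
    have "lam v x = t v" if "v \<in> C" for v
      using coord[OF that t] x by simp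
    then show ?thesis
      using t by (simp flip: x)
  qed
  show ?thesis
    by (intro exI[of _ a] exI[of _ c] barycentric.intro fin)
      (use vertex expand in \<open>simp_all add: lam_def\<close>)
qed

context barycentric
begin

lemma sum_constants: "(\<Sum>v\<in>C. a v) = 1" and sum_constants_vertex: "(\<Sum>v\<in>C. a v * v $ k) = 0"
  using coordinates_sum_one[of 0] coordinates_reproduce[of 0 k] by simp_all

lemma sum_coefficients: "(\<Sum>v\<in>C. c v j) = 0"
  and sum_coefficients_vertex: "(\<Sum>v\<in>C. c v j * v $ k) = (if j = k then 1 else 0)"
proof -
  have *: "(\<Sum>i\<in>UNIV. c v i * axis j 1 $ i) = c v j" for v
    by (simp add: axis_def if_distrib cong: if_cong)
  show "(\<Sum>v\<in>C. c v j) = 0"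
    using coordinates_sum_one[of "axis j 1"] by (simp add: * sum.distrib sum_constants)
  show "(\<Sum>v\<in>C. c v j * v $ k) = (if j = k then 1 else 0)"
    using coordinates_reproduce[of "axis j 1" k] unfolding *
    by (simp add: sum.distrib distrib_right sum_constants_vertex) (auto simp: axis_def)
qed

lemma coordinate_nonneg:
  assumes "v \<in> C" "x \<in> convex hull C"
  shows "0 \<le> a v + (\<Sum>j\<in>UNIV. c v j * x $ j)"
proof -
  obtain t where t: "\<forall>w\<in>C. 0 \<le> t w" "sum t C = 1" and x: "(\<Sum>w\<in>C. t w *\<^sub>R w) = x"
    using assms(2) convex_hull_finite[OF finite] by auto
  have "(\<Sum>j\<in>UNIV. c v j * x $ j) = (\<Sum>w\<in>C. t w * (\<Sum>j\<in>UNIV. c v j * w $ j))"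
    unfolding x[symmetric] sum_component sum_distrib_left
    by (subst sum.swap) (simp add: mult_ac)
  then have "a v + (\<Sum>j\<in>UNIV. c v j * x $ j)
      = (\<Sum>w\<in>C. t w * (a v + (\<Sum>j\<in>UNIV. c v j * w $ j)))"
    using t(2) by (simp add: distrib_left sum.distrib flip: sum_distrib_right)
  also have "\<dots> \<ge> 0"
    using t(1) assms(1) by (intro sum_nonneg mult_nonneg_nonneg) (auto simp: coordinate_vertex)
  finally show ?thesis .
qed

text \<open>The barycentric coordinate at \<open>v\<close>, evaluated at the operator tuple \<open>T\<close>.\<close>

definition coord_op :: "('m \<Rightarrow> 'a::chilbert_space \<Rightarrow> 'a) \<Rightarrow> real ^ 'm \<Rightarrow> 'a \<Rightarrow> 'a"
  where "coord_op T v x = complex_of_real (a v) *\<^sub>C x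
    + (\<Sum>j\<in>UNIV. complex_of_real (c v j) *\<^sub>C T j x)"

lemma coord_op_sum: "(\<Sum>v\<in>C. coord_op T v x) = x"
proof -
  have "(\<Sum>v\<in>C. coord_op T v x) = complex_of_real (\<Sum>v\<in>C. a v) *\<^sub>C x
      + (\<Sum>j\<in>UNIV. complex_of_real (\<Sum>v\<in>C. c v j) *\<^sub>C T j x)"
    unfolding coord_op_def sum.distrib of_real_sum scaleC_sum_left by (subst sum.swap) simp
  then show ?thesis
    by (simp only: sum_constants sum_coefficients) simp
qed

lemma coord_op_reproduce:
  "(\<Sum>v\<in>C. complex_of_real (v $ k) *\<^sub>C coord_op T v x) = T k x"
proof -
  have "(\<Sum>v\<in>C. complex_of_real (v $ k) *\<^sub>C coord_op T v x)
      = (\<Sum>v\<in>C. complex_of_real (a v * v $ k) *\<^sub>C x)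
        + (\<Sum>v\<in>C. \<Sum>j\<in>UNIV. complex_of_real (c v j * v $ k) *\<^sub>C T j x)"
    by (simp add: coord_op_def scaleC_add_right sum.distrib scaleC_sum_right scaleC_scaleC
        mult.commute)
  also have "\<dots> = complex_of_real (\<Sum>v\<in>C. a v * v $ k) *\<^sub>C x
        + (\<Sum>j\<in>UNIV. complex_of_real (\<Sum>v\<in>C. c v j * v $ k) *\<^sub>C T j x)"
    unfolding of_real_sum scaleC_sum_left by (subst (2) sum.swap) simp
  also have "\<dots> = (\<Sum>j\<in>UNIV. if j = k then T j x else 0)"
    unfolding sum_constants_vertex sum_coefficients_vertex
    by (simp add: if_distrib[of complex_of_real] if_distrib[of "\<lambda>s. s *\<^sub>C _"] cong: if_cong)
  finally show ?thesis
    by simp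
qed

text \<open>
  An affine function is the sum of its values at the vertices times the barycentric coordinates; the
  same holds after evaluation at \<open>T\<close>.
\<close>

lemma coord_op_combination:
  "(\<Sum>v\<in>C. (\<alpha> + (\<Sum>j\<in>UNIV. \<beta> j * complex_of_real (v $ j))) *\<^sub>C coord_op T v x)
    = \<alpha> *\<^sub>C x + (\<Sum>j\<in>UNIV. \<beta> j *\<^sub>C T j x)"
proof -
  have "(\<Sum>v\<in>C. (\<alpha> + (\<Sum>j\<in>UNIV. \<beta> j * complex_of_real (v $ j))) *\<^sub>C coord_op T v x)
      = \<alpha> *\<^sub>C (\<Sum>v\<in>C. coord_op T v x)
        + (\<Sum>j\<in>UNIV. \<beta> j *\<^sub>C (\<Sum>v\<in>C. complex_of_real (v $ j) *\<^sub>C coord_op T v x))"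
    unfolding scaleC_add_left sum.distrib scaleC_sum_left scaleC_sum_right scaleC_scaleC
    by (subst sum.swap) simp
  then show ?thesis
    by (simp only: coord_op_sum coord_op_reproduce)
qed

lemma bounded_clinear_coord_op:
  assumes "\<And>j. bounded_clinear (T j)"
  shows "bounded_clinear (coord_op T v)"
  unfolding coord_op_def[abs_def] using assms
  by (intro bounded_clinear_plus bounded_clinear_scale bounded_clinear_id
      bounded_clinear_linear_combination)

lemma cinner_coord_op:
  assumes "\<And>j. cinner (T j x) x = complex_of_real (p $ j)" "cinner x x = 1"
  shows "cinner (coord_op T v x) x = complex_of_real (a v + (\<Sum>j\<in>UNIV. c v j * p $ j))"
  by (simp add: coord_op_def cinner_add_left cinner_sum_left cinner_scaleC_left assms)

text \<open>
  On a unit vector \<open>u\<close> the quadratic form of \<open>coord_op T v\<close> is the coordinate at \<open>v\<close> of the point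
  \<open>(\<langle>T\<^sub>j u, u\<rangle>)\<^sub>j\<close> of the simplex.
\<close>

lemma psd_op_coord_op:
  assumes T: "\<And>j. bounded_clinear (T j)"
    and range: "joint_numerical_range T \<subseteq> complex_vec ` (convex hull C)"
    and v: "v \<in> C"
  shows "psd_op (coord_op T v)"
  unfolding psd_op_def
proof
  fix x
  show "cinner (coord_op T v x) x \<in> \<real>\<^sub>\<ge>\<^sub>0"
  proof (cases "x = 0")
    case False
    define r where "r = complex_of_real (norm x)"
    define u where "u = (1 / r) *\<^sub>C x"
    have x: "x = r *\<^sub>C u" and u: "cinner u u = 1"
      using False by (simp_all add: u_def r_def scaleC_scaleC cinner_self norm_scaleC norm_divide)
    have "(\<chi> j. cinner (T j u) u) \<in> joint_numerical_range T"
      unfolding joint_numerical_range_def using u by blast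
    then obtain p where p: "p \<in> convex hull C" and eq: "(\<chi> j. cinner (T j u) u) = complex_vec p"
      using range by blast
    have "cinner (T j u) u = complex_of_real (p $ j)" for j
      using arg_cong[OF eq, of "\<lambda>z. z $ j"] by (simp add: complex_vec_def)
    from cinner_coord_op[of T, OF this u] have "cinner (coord_op T v u) u \<in> \<real>\<^sub>\<ge>\<^sub>0"
      using coordinate_nonneg[OF v p] by (simp only: nonneg_Reals_of_real_iff)
    moreover have "cinner (coord_op T v x) x = complex_of_real ((norm x)\<^sup>2) * cinner (coord_op T v u) u"
      unfolding x bounded_clinear_scaleC[OF bounded_clinear_coord_op[OF T]] cinner_scaleC_left
        cinner_scaleC_right
      using False u by (simp add: r_def norm_scaleC power2_eq_square cinner_self)
    ultimately show ?thesis
      by (metis nonneg_Reals_mult_I nonneg_Reals_of_real_iff zero_le_power2)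
  qed simp
qed

text \<open>
  A vertex \<open>v\<close> is attained in the joint numerical range by a unit vector \<open>e\<close>.  The other coordinates
  of \<open>v\<close> are zero, so \<open>e\<close> is isotropic for the positive operators \<open>coord_op T w\<close>, \<open>w \<noteq> v\<close>, and therefore
  lies in their kernels.  As all coordinate operators sum to the identity, \<open>coord_op T v\<close> fixes \<open>e\<close>.
\<close>

lemma coord_op_vertex_vectors:
  assumes T: "\<And>j. bounded_clinear (T j)"
    and range: "joint_numerical_range T = complex_vec ` (convex hull C)"
  shows "\<exists>e. \<forall>v\<in>C. cinner (e v) (e v) = 1 \<and>
    (\<forall>w\<in>C. coord_op T w (e v) = (if w = v then e v else 0))"
proof (rule bchoice, rule ballI)
  fix v
  assume v: "v \<in> C"
  then have "complex_vec v \<in> joint_numerical_range T"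
    unfolding range by (intro imageI hull_inc)
  then obtain e where eq: "complex_vec v = (\<chi> j. cinner (T j e) e)" and e: "cinner e e = 1"
    by (auto simp: joint_numerical_range_def)
  have "cinner (T j e) e = complex_of_real (v $ j)" for j
    using arg_cong[OF eq, of "\<lambda>z. z $ j"] by (simp add: complex_vec_def)
  then have diag: "cinner (coord_op T w e) e = (if w = v then 1 else 0)" if "w \<in> C" for w
    using e v that by (subst cinner_coord_op[of T e v]) (auto simp: coordinate_vertex)
  have kernel: "coord_op T w e = 0" if w: "w \<in> C" "w \<noteq> v" for w
  proof -
    interpret psd_form "\<lambda>x y. cinner (coord_op T w x) y"
      using T range w(1)
      by (intro psd_op_psd_form bounded_clinear_coord_op psd_op_coord_op) auto
    have "cinner (coord_op T w e) (coord_op T w e) = 0"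
      using diag[OF w(1)] w(2) by (intro isotropic_orthogonal) simp
    then show ?thesis
      by simp
  qed
  have "e = (\<Sum>w\<in>C. coord_op T w e)"
    by (rule coord_op_sum[symmetric])
  also have "\<dots> = coord_op T v e"
    using kernel v finite by (subst sum.remove[of _ v]) (auto intro: sum.neutral)
  finally have "coord_op T v e = e" ..
  then show "\<exists>e. cinner e e = 1 \<and> (\<forall>w\<in>C. coord_op T w e = (if w = v then e else 0))"
    using e kernel by (intro exI[of _ e]) auto
qed

end

text \<open>
  The vectors \<open>e v\<close> are orthogonal because they belong to different eigenvalues of the symmetric
  operators \<open>coord_op H v\<close>.
\<close>

theorem (in barycentric) has_joint_dilation_if_range_subset:
  fixes H :: "'m \<Rightarrow> 'h::chilbert_space \<Rightarrow> 'h" and B :: "'m \<Rightarrow> 'k::chilbert_space \<Rightarrow> 'k"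
  assumes H: "\<And>j. bounded_clinear (H j)" and B: "\<And>j. bounded_clinear (B j)"
    and range: "joint_numerical_range H = complex_vec ` (convex hull C)"
    and subset: "joint_numerical_range B \<subseteq> joint_numerical_range H"
  shows "has_joint_dilation H B"
proof -
  obtain e where e: "\<And>v. v \<in> C \<Longrightarrow> cinner (e v) (e v) = 1"
    and coord_e: "\<And>v w. v \<in> C \<Longrightarrow> w \<in> C \<Longrightarrow> coord_op H w (e v) = (if w = v then e v else 0)"
    using coord_op_vertex_vectors[OF H range] by metis
  show ?thesis
  proof (rule has_joint_dilation_from_joint_eigenvectors[where C = C and e = e
        and Q = "coord_op B" and d = "\<lambda>j v. complex_of_real (v $ j)"])
    show "cinner (e v) (e w) = (if v = w then 1 else 0)" if "v \<in> C" "w \<in> C" for v w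
    proof (cases "v = w")
      case False
      have "cinner (coord_op H v (e v)) (e w) = cinner (e v) (coord_op H v (e w))"
        using range that
        by (intro psd_op_symmetric bounded_clinear_coord_op psd_op_coord_op H) auto
      then show ?thesis
        using False that by (simp add: coord_e)
    qed (use e that in simp)
    show "H j (e v) = complex_of_real (v $ j) *\<^sub>C e v" if v: "v \<in> C" for j v
    proof -
      have "H j (e v) = (\<Sum>w\<in>C. complex_of_real (w $ j) *\<^sub>C coord_op H w (e v))"
        by (rule coord_op_reproduce[symmetric])
      also have "\<dots> = (\<Sum>w\<in>C. if w = v then complex_of_real (w $ j) *\<^sub>C e v else 0)"
        using coord_e[OF v] by (intro sum.cong) auto
      finally show ?thesis
        using finite v by simp
    qed
    show "psd_op (coord_op B v)" if "v \<in> C" for v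
      using subset range that by (intro psd_op_coord_op B) auto
  qed (simp_all add: finite H B bounded_clinear_coord_op coord_op_sum coord_op_reproduce)
qed


section \<open>Maximal operator systems\<close>

lemma operator_system_span_with_identity:
  fixes H :: "'m::finite \<Rightarrow> 'h::chilbert_space \<Rightarrow> 'h"
  assumes bounded: "\<And>j. bounded_clinear (H j)" and selfadj: "\<And>j. selfadjoint (H j)"
  shows "operator_system (span_with_identity H)"
  unfolding operator_system_def
proof (intro conjI ballI allI)
  note span = span_with_identity_def[of H]
  have span_I: "S \<in> span_with_identity H"
    if "\<And>x. S x = \<alpha> *\<^sub>C x + (\<Sum>j\<in>UNIV. \<beta> j *\<^sub>C H j x)" for S \<alpha> \<beta>
    using that unfolding span by auto
  show "(\<lambda>x. x) \<in> span_with_identity H"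
    by (rule span_I[of _ 1 "\<lambda>_. 0"]) simp
  fix S
  assume "S \<in> span_with_identity H"
  then obtain \<alpha> \<beta> where S: "S = (\<lambda>x. \<alpha> *\<^sub>C x + (\<Sum>j\<in>UNIV. \<beta> j *\<^sub>C H j x))"
    by (auto simp: span)
  show "bounded_clinear S"
    unfolding S using bounded
    by (intro bounded_clinear_plus bounded_clinear_scale bounded_clinear_id
        bounded_clinear_linear_combination)
  show "(\<lambda>x. a *\<^sub>C S x) \<in> span_with_identity H" for a
    by (rule span_I[of _ "a * \<alpha>" "\<lambda>j. a * \<beta> j"])
      (simp add: S scaleC_add_right scaleC_sum_right scaleC_scaleC)
  show "\<exists>T\<in>span_with_identity H. adjoint_of S T"
  proof
    show "(\<lambda>x. cnj \<alpha> *\<^sub>C x + (\<Sum>j\<in>UNIV. cnj (\<beta> j) *\<^sub>C H j x)) \<in> span_with_identity H"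
      by (rule span_I) simp
    have "cinner (H j x) y = cinner x (H j y)" for j x y
      using selfadj by (simp add: selfadjoint_def adjoint_of_def)
    then show "adjoint_of S (\<lambda>x. cnj \<alpha> *\<^sub>C x + (\<Sum>j\<in>UNIV. cnj (\<beta> j) *\<^sub>C H j x))"
      by (simp add: S adjoint_of_def cinner_add_left cinner_add_right cinner_sum_left
          cinner_sum_right cinner_scaleC_left cinner_scaleC_right)
  qed
  fix T
  assume "T \<in> span_with_identity H"
  then obtain \<alpha>' \<beta>' where T: "T = (\<lambda>x. \<alpha>' *\<^sub>C x + (\<Sum>j\<in>UNIV. \<beta>' j *\<^sub>C H j x))"
    by (auto simp: span)
  show "(\<lambda>x. S x + T x) \<in> span_with_identity H"
    by (rule span_I[of _ "\<alpha> + \<alpha>'" "\<lambda>j. \<beta> j + \<beta>' j"])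
      (simp add: S T scaleC_add_left sum.distrib)
qed

lemma linear_map_on_linear_combination:
  assumes sys: "operator_system \<S>" and \<Phi>: "linear_map_on \<S> \<Phi>"
    and T: "\<And>j. j \<in> F \<Longrightarrow> T j \<in> \<S>"
  shows "(\<lambda>x. \<Sum>j\<in>F. \<beta> j *\<^sub>C T j x) \<in> \<S> \<and>
    \<Phi> (\<lambda>x. \<Sum>j\<in>F. \<beta> j *\<^sub>C T j x) = (\<lambda>x. \<Sum>j\<in>F. \<beta> j *\<^sub>C \<Phi> (T j) x)"
proof -
  have scale: "(\<lambda>x. b *\<^sub>C S x) \<in> \<S>" "\<Phi> (\<lambda>x. b *\<^sub>C S x) = (\<lambda>x. b *\<^sub>C \<Phi> S x)" if "S \<in> \<S>" for b S
    using sys \<Phi> that by (auto simp: operator_system_def linear_map_on_def)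
  have plus: "(\<lambda>x. R x + S x) \<in> \<S>" "\<Phi> (\<lambda>x. R x + S x) = (\<lambda>x. \<Phi> R x + \<Phi> S x)"
    if "R \<in> \<S>" "S \<in> \<S>" for R S
    using sys \<Phi> that by (auto simp: operator_system_def linear_map_on_def)
  have zero: "(\<lambda>x. 0) \<in> \<S> \<and> \<Phi> (\<lambda>x. 0) = (\<lambda>x. 0)"
    using sys scale[of "\<lambda>x. x" 0] by (simp add: operator_system_def)
  show ?thesis
    using T
  proof (induction F rule: infinite_finite_induct)
    case (insert j F)
    then show ?case
      using scale[of "T j" "\<beta> j"] plus[of "\<lambda>x. \<beta> j *\<^sub>C T j x" "\<lambda>x. \<Sum>j\<in>F. \<beta> j *\<^sub>C T j x"] by simp
  qed (simp_all add: zero)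
qed

lemma sum_nonneg_Reals:
  "(\<And>i. i \<in> F \<Longrightarrow> f i \<in> \<real>\<^sub>\<ge>\<^sub>0) \<Longrightarrow> (\<Sum>i\<in>F. f i :: complex) \<in> \<real>\<^sub>\<ge>\<^sub>0"
  by (induction F rule: infinite_finite_induct) auto

lemma has_sum_nonneg_Reals:
  fixes f :: "'i \<Rightarrow> complex"
  assumes "(f has_sum s) A" "\<And>i. i \<in> A \<Longrightarrow> f i \<in> \<real>\<^sub>\<ge>\<^sub>0"
  shows "s \<in> \<real>\<^sub>\<ge>\<^sub>0"
proof -
  have "0 \<le> Re s"
    using has_sum_Re[OF assms(1)] by (rule has_sum_nonneg)
      (use assms(2) in \<open>auto simp: complex_nonneg_Reals_iff\<close>)
  moreover have "((\<lambda>i. 0) has_sum Im s) A"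
    using has_sum_Im[OF assms(1)]
    by (rule has_sum_cong[THEN iffD1, rotated])
      (use assms(2) in \<open>auto simp: complex_nonneg_Reals_iff\<close>)
  then have "Im s = 0"
    using has_sum_unique has_sum_0_simp by blast
  ultimately show ?thesis
    by (simp add: complex_nonneg_Reals_iff)
qed

text \<open>
  As in Schur's product theorem: writing \<open>S\<close> as a sum of rank one operators makes the expression a
  sum of values of the positive quadratic form of \<open>M\<close>.
\<close>

lemma psd_matrix_pairing_nonneg:
  fixes S :: "'k::chilbert_space \<Rightarrow> 'k"
  assumes S: "bounded_clinear S" "psd_op S"
    and M: "\<And>\<xi> :: nat \<Rightarrow> complex. (\<Sum>i<k. \<Sum>j<k. M i j * (\<xi> j * cnj (\<xi> i))) \<in> \<real>\<^sub>\<ge>\<^sub>0"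
  shows "(\<Sum>i<k. \<Sum>j<k. M i j * cinner (S (x j)) (x i)) \<in> \<real>\<^sub>\<ge>\<^sub>0"
proof -
  interpret psd_form "\<lambda>x y. cinner (S x) y"
    using S by (rule psd_op_psd_form)
  obtain f :: "'k \<Rightarrow> 'k \<Rightarrow> complex" where "\<And>b. clinear_functional (f b)"
    and f: "\<And>y z. ((\<lambda>b. f b y * cnj (f b z)) has_sum cinner (S y) z) UNIV"
    using transfinite_Cholesky by blast
  have "((\<lambda>b. \<Sum>i<k. \<Sum>j<k. M i j * (f b (x j) * cnj (f b (x i))))
      has_sum (\<Sum>i<k. \<Sum>j<k. M i j * cinner (S (x j)) (x i))) UNIV"
    by (intro has_sum_sum has_sum_cmult_right f)
  then show ?thesis
    using M by (rule has_sum_nonneg_Reals)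
qed

text \<open>
  All operators in the span are simultaneously diagonal on the vectors \<open>e v\<close>, with eigenvalues
  \<open>s v S\<close>, and \<open>\<Phi>\<close> acts on them through these eigenvalues.  Testing a positive matrix
  over the span on vectors \<open>\<xi> j *\<^sub>C e v\<close> shows that its matrices of eigenvalues are positive.
\<close>

theorem (in barycentric) maximal_operator_system_span:
  fixes H :: "'m \<Rightarrow> 'h::chilbert_space \<Rightarrow> 'h"
  assumes bounded: "\<And>j. bounded_clinear (H j)" and selfadj: "\<And>j. selfadjoint (H j)"
    and range: "joint_numerical_range H = complex_vec ` (convex hull C)"
  shows "maximal_operator_system TYPE('k::chilbert_space) (span_with_identity H)"
  unfolding maximal_operator_system_def
proof (intro conjI allI impI)
  let ?\<S> = "span_with_identity H"
  show sys: "operator_system ?\<S>"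
    using bounded selfadj by (rule operator_system_span_with_identity)
  fix \<Phi> :: "('h \<Rightarrow> 'h) \<Rightarrow> ('k \<Rightarrow> 'k)"
  assume lin: "linear_map_on ?\<S> \<Phi>" and unital: "unital_map \<Phi>" and pos: "positive_map_on ?\<S> \<Phi>"
  obtain e where e: "\<And>v. v \<in> C \<Longrightarrow> cinner (e v) (e v) = 1"
    and coord_e: "\<And>v w. v \<in> C \<Longrightarrow> w \<in> C \<Longrightarrow> coord_op H w (e v) = (if w = v then e v else 0)"
    using coord_op_vertex_vectors[OF bounded range] by metis
  define Q where "Q v = coord_op (\<lambda>j. \<Phi> (H j)) v" for v
  have id_mem: "(\<lambda>x. x) \<in> ?\<S>"
    using sys by (simp add: operator_system_def)
  have comb_mem: "(\<lambda>x. \<alpha> *\<^sub>C x + (\<Sum>j\<in>UNIV. \<beta> j *\<^sub>C H j x)) \<in> ?\<S>" for \<alpha> \<beta>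
    by (auto simp: span_with_identity_def)
  have H_mem: "H j \<in> ?\<S>" for j
  proof -
    have "H j = (\<lambda>x. 0 *\<^sub>C x + (\<Sum>i\<in>UNIV. (if i = j then 1 else 0) *\<^sub>C H i x))"
      by (simp add: if_distrib[of "\<lambda>s. s *\<^sub>C _"] cong: if_cong)
    then show ?thesis
      using comb_mem by metis
  qed
  have \<Phi>_comb: "\<Phi> (\<lambda>x. \<alpha> *\<^sub>C x + (\<Sum>j\<in>UNIV. \<beta> j *\<^sub>C H j x))
      = (\<lambda>x. \<alpha> *\<^sub>C x + (\<Sum>j\<in>UNIV. \<beta> j *\<^sub>C \<Phi> (H j) x))" for \<alpha> \<beta>
  proof -
    have "(\<lambda>x. \<alpha> *\<^sub>C x) \<in> ?\<S>" "\<Phi> (\<lambda>x. \<alpha> *\<^sub>C x) = (\<lambda>x. \<alpha> *\<^sub>C x)"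
      using sys lin unital id_mem by (auto simp: operator_system_def linear_map_on_def unital_map_def)
    moreover note linear_map_on_linear_combination[where F = UNIV and \<beta> = \<beta>, OF sys lin H_mem]
    ultimately show ?thesis
      using lin by (auto simp: linear_map_on_def)
  qed
  have \<Phi>_coord: "\<Phi> (coord_op H v) = Q v" for v
    unfolding Q_def coord_op_def[abs_def] by (rule \<Phi>_comb)
  have coord_mem: "coord_op H v \<in> ?\<S>" for v
    unfolding coord_op_def[abs_def] by (rule comb_mem)
  have Q_bounded: "bounded_clinear (Q v)" for v
    using lin coord_mem[of v] by (simp add: linear_map_on_def flip: \<Phi>_coord)
  have Q_psd: "psd_op (Q v)" if "v \<in> C" for v
    using pos coord_mem[of v] psd_op_coord_op[OF bounded _ that] range
    by (simp add: positive_map_on_def flip: \<Phi>_coord)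
  define s where "s v S = cinner (S (e v)) (e v)" for v S
  have diagonal: "(\<forall>v\<in>C. S (e v) = s v S *\<^sub>C e v) \<and> (\<forall>x. \<Phi> S x = (\<Sum>v\<in>C. s v S *\<^sub>C Q v x))"
    if S_mem: "S \<in> ?\<S>" for S
  proof -
    obtain \<alpha> \<beta> where S: "S = (\<lambda>x. \<alpha> *\<^sub>C x + (\<Sum>j\<in>UNIV. \<beta> j *\<^sub>C H j x))"
      using S_mem by (auto simp: span_with_identity_def)
    define t where "t v = \<alpha> + (\<Sum>j\<in>UNIV. \<beta> j * complex_of_real (v $ j))" for v :: "real ^ 'm"
    have eig: "S (e v) = t v *\<^sub>C e v" if v: "v \<in> C" for v
    proof -
      have "S (e v) = (\<Sum>w\<in>C. t w *\<^sub>C coord_op H w (e v))"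
        unfolding S t_def by (rule coord_op_combination[symmetric])
      also have "\<dots> = (\<Sum>w\<in>C. if w = v then t w *\<^sub>C e v else 0)"
        using coord_e[OF v] by (intro sum.cong) auto
      finally show ?thesis
        using finite v by simp
    qed
    then have st: "s v S = t v" if "v \<in> C" for v
      using e that by (simp add: s_def cinner_scaleC_left)
    have "\<Phi> S x = (\<Sum>v\<in>C. t v *\<^sub>C Q v x)" for x
      unfolding S \<Phi>_comb t_def Q_def by (rule coord_op_combination[symmetric])
    then show ?thesis
      using eig st by simp
  qed
  show "completely_positive_on ?\<S> \<Phi>"
    unfolding completely_positive_on_def psd_op_matrix_def
  proof (intro allI impI)
    fix k :: nat and S and x :: "nat \<Rightarrow> 'k"
    assume mem: "\<forall>i<k. \<forall>j<k. S i j \<in> ?\<S>"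
      and psd: "\<forall>x. (\<Sum>i<k. cinner (\<Sum>j<k. S i j (x j)) (x i)) \<in> \<real>\<^sub>\<ge>\<^sub>0"
    have scalar: "(\<Sum>i<k. \<Sum>j<k. s v (S i j) * (\<xi> j * cnj (\<xi> i))) \<in> \<real>\<^sub>\<ge>\<^sub>0"
      if v: "v \<in> C" for v and \<xi> :: "nat \<Rightarrow> complex"
    proof -
      have "cinner (S i j (\<xi> j *\<^sub>C e v)) (\<xi> i *\<^sub>C e v) = s v (S i j) * (\<xi> j * cnj (\<xi> i))"
        if "i < k" "j < k" for i j
      proof -
        have Sij: "S i j \<in> ?\<S>"
          using mem that by blast
        then have "bounded_clinear (S i j)"
          using sys by (simp add: operator_system_def)
        then show ?thesis
          using diagonal[OF Sij] v e[OF v]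
          by (simp add: bounded_clinear_scaleC cinner_scaleC_left cinner_scaleC_right)
      qed
      then have "(\<Sum>i<k. cinner (\<Sum>j<k. S i j (\<xi> j *\<^sub>C e v)) (\<xi> i *\<^sub>C e v))
          = (\<Sum>i<k. \<Sum>j<k. s v (S i j) * (\<xi> j * cnj (\<xi> i)))"
        unfolding cinner_sum_left by (intro sum.cong) auto
      then show ?thesis
        using psd[rule_format, of "\<lambda>j. \<xi> j *\<^sub>C e v"] by simp
    qed
    have "(\<Sum>i<k. cinner (\<Sum>j<k. \<Phi> (S i j) (x j)) (x i))
        = (\<Sum>i<k. \<Sum>j<k. \<Sum>v\<in>C. s v (S i j) * cinner (Q v (x j)) (x i))"
      using mem diagonal
      by (intro sum.cong) (auto simp: cinner_sum_left cinner_scaleC_left intro!: sum.cong)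
    also have "\<dots> = (\<Sum>i<k. \<Sum>v\<in>C. \<Sum>j<k. s v (S i j) * cinner (Q v (x j)) (x i))"
      by (intro sum.cong refl sum.swap)
    also have "\<dots> = (\<Sum>v\<in>C. \<Sum>i<k. \<Sum>j<k. s v (S i j) * cinner (Q v (x j)) (x i))"
      by (rule sum.swap)
    also have "\<dots> \<in> \<real>\<^sub>\<ge>\<^sub>0"
      by (intro sum_nonneg_Reals psd_matrix_pairing_nonneg Q_bounded Q_psd scalar)
    finally show "(\<Sum>i<k. cinner (\<Sum>j<k. \<Phi> (S i j) (x j)) (x i)) \<in> \<real>\<^sub>\<ge>\<^sub>0" .
  qed
qed


section \<open>Simplicial joint numerical ranges\<close>

theorem theorem2p5:
  fixes H :: "'m::finite \<Rightarrow> 'h::chilbert_space \<Rightarrow> 'h"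
  assumes bounded: "\<And>j. bounded_clinear (H j)"
    and selfadj: "\<And>j. selfadjoint (H j)"
    and simplex: "\<exists>\<Delta> :: (real ^ 'm) set.
      int CARD('m) simplex \<Delta> \<and> joint_numerical_range H = complex_vec ` \<Delta>"
  shows "(\<forall>B :: 'm \<Rightarrow> 'k::chilbert_space \<Rightarrow> 'k.
            (\<forall>j. bounded_clinear (B j)) \<longrightarrow>
            joint_numerical_range B \<subseteq> joint_numerical_range H \<longrightarrow>
            has_joint_dilation H B) \<and>
         maximal_operator_system TYPE('k) (span_with_identity H)"
proof -
  obtain C :: "(real ^ 'm) set" where C: "\<not> affine_dependent C" "int (card C) = int CARD('m) + 1"
    and range: "joint_numerical_range H = complex_vec ` (convex hull C)"
    using simplex by (auto simp: simplex_def)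
  obtain a c where "barycentric C a c"
    using barycentric_exists[OF C] by blast
  then interpret barycentric C a c .
  show ?thesis
    using has_joint_dilation_if_range_subset[OF bounded _ range]
      maximal_operator_system_span[OF bounded selfadj range] by blast
qed

end
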